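(* Let $D$ be a digraph on $[n]$ with adjacency matrix $A$, $\overline{A}=\vec 1\vec 1^T-A$, and $X=\mathrm{diag}(x_1,\ldots,x_n)$. Then the following are equivalent expressions for $\mathcal U_D$: (a) $\mathcal{U}_D=\mathfrak{L}_n\,\det H_{\vec z}(X\overline{A})\cdot\det E_{\vec z}(XA)$; (b) $\mathcal{U}_D=\mathfrak{L}_n\exp\Big(\sum_{k\ge1}\frac1k p_k\big(\mathrm{tr}(X\overline{A})^k+(-1)^{k-1}\mathrm{tr}(XA)^k\big)\Big)$; (c) $\displaystyle\mathcal{U}_D=\sum_{I\subseteq[n]}\Big(\sum_{\sigma\in\mathfrak{S}_{[n]\setminus I}}p_{\mathrm{cyc}(\sigma)}\prod_{i\in [n]\setminus I}\overline{A}_{i,\sigma(i)}\Big)\Big(\sum_{\tau\in\mathfrak{S}_I}p_{\mathrm{cyc}(\tau)}\,\mathrm{sgn}(\tau)\prod_{i\in I}A_{i,\tau(i)}\Big)$.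
   Context: A digraph on $[n]$ has edge set $E\subseteq[n]\times[n]$ (loops allowed), $A_{ij}=1$ iff $(i,j)\in E$; $\vec 1$ is the all-ones vector, so $\overline A$ is the adjacency matrix of the complement (edge $(u,v)$, including $u=v$, iff $(u,v)\notin E$). For $\pi=\pi_1\cdots\pi_n\in\mathfrak S_n$, $i\in[n-1]$ is a $D$-descent if $(\pi_i,\pi_{i+1})\in E$; $\mathrm{Des}_D(\pi)$ is the set of $D$-descents. The Rédei–Berge symmetric function is $\mathcal U_D=\sum_{\pi\in\mathfrak S_n}F_{\mathrm{Des}_D(\pi)}$, where for $J\subseteq[n-1]$, $F_J=\sum z_{i_1}\cdots z_{i_n}$ over $1\le i_1\le\cdots\le i_n$ with $i_j<i_{j+1}$ for $j\in J$. $h_j,e_j,p_k$ are the complete homogeneous, elementary, and power sum symmetric functions in $\vec z=(z_1,z_2,\ldots)$; $H_{\vec z}(M)=\sum_j h_jM^j$, $E_{\vec z}(M)=\sum_je_jM^j$. $\mathfrak L_n f$ is the coefficient of $x_1x_2\cdots x_n$ in $f$. $\mathfrak S_I$ is the permutation group of $I$; $p_{\mathrm{cyc}(\sigma)}=\prod_{\text{cycles }c\text{ of }\sigma}p_{|c|}$ (fixed points count as 1-cycles; empty permutation gives $1$). *)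

theory Defs
  imports
    "HOL-Library.Multiset"
    "HOL-Library.FuncSet"
    "HOL-Combinatorics.Permutations"
    "HOL-Combinatorics.Orbits"
    "Jordan_Normal_Form.Matrix"
    "Jordan_Normal_Form.Determinant"
begin

text \<open>
  Formal power series in commuting variables indexed by a (possibly infinite) type \<open>'v\<close>: a
  monomial is a finite multiset of variables, and a series is an arbitrary function from monomials
  to coefficients.
\<close>

typedef ('v, 'a) mps = "UNIV :: ('v multiset \<Rightarrow> 'a) set"
  morphisms mps_coeff Abs_mps by simp

setup_lifting type_definition_mps

lemma mps_eqI: "(\<And>m. mps_coeff f m = mps_coeff g m) \<Longrightarrow> f = g"
  by (metis ext mps_coeff_inject)

lemma finite_submultisets: "finite {a. a \<subseteq># (m :: 'v multiset)}"
proof (induction m)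
  case (add x m)
  have "{a. a \<subseteq># add_mset x m} \<subseteq> {a. a \<subseteq># m} \<union> add_mset x ` {a. a \<subseteq># m}"
  proof
    fix a assume a: "a \<in> {a. a \<subseteq># add_mset x m}"
    show "a \<in> {a. a \<subseteq># m} \<union> add_mset x ` {a. a \<subseteq># m}"
    proof (cases "x \<in># a")
      case True
      then obtain b where "a = add_mset x b" by (metis multi_member_split)
      with a show ?thesis by auto
    next
      case False
      with a show ?thesis
        by (metis (no_types, lifting) UnI1 add_mset_remove_trivial diff_single_trivial
            mem_Collect_eq subset_eq_diff_conv add_mset_add_single)
    qed
  qed
  then show ?case using add.IH finite_subset by blast
qed simp

instantiation mps :: (type, zero) zero
begin
lift_definition zero_mps :: "('a, 'b) mps" is "\<lambda>_. 0" .
instance ..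
end

instantiation mps :: (type, "{zero,one}") one
begin
lift_definition one_mps :: "('a, 'b) mps" is "\<lambda>m. if m = {#} then 1 else 0" .
instance ..
end

instantiation mps :: (type, plus) plus
begin
lift_definition plus_mps :: "('a, 'b) mps \<Rightarrow> ('a, 'b) mps \<Rightarrow> ('a, 'b) mps" is "\<lambda>f g m. f m + g m" .
instance ..
end

instantiation mps :: (type, minus) minus
begin
lift_definition minus_mps :: "('a, 'b) mps \<Rightarrow> ('a, 'b) mps \<Rightarrow> ('a, 'b) mps" is "\<lambda>f g m. f m - g m" .
instance ..
end

instantiation mps :: (type, uminus) uminus
begin
lift_definition uminus_mps :: "('a, 'b) mps \<Rightarrow> ('a, 'b) mps" is "\<lambda>f m. - f m" .
instance ..
end

instantiation mps :: (type, "{comm_monoid_add,times}") times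
begin
lift_definition times_mps :: "('a, 'b) mps \<Rightarrow> ('a, 'b) mps \<Rightarrow> ('a, 'b) mps"
  is "\<lambda>f g m. \<Sum>a\<in>{a. a \<subseteq># m}. f a * g (m - a)" .
instance ..
end

lemma mps_mult_assoc:
  fixes f g h :: "('v, 'a::comm_ring_1) mps"
  shows "f * g * h = f * (g * h)"
proof (rule mps_eqI)
  fix m :: "'v multiset"
  let ?P = "\<lambda>m. {a :: 'v multiset. a \<subseteq># m}"
  let ?f = "mps_coeff f" and ?g = "mps_coeff g" and ?h = "mps_coeff h"
  have "mps_coeff (f * g * h) m = (\<Sum>s\<in>?P m. \<Sum>a\<in>?P s. ?f a * ?g (s - a) * ?h (m - s))"
    by (simp add: times_mps.rep_eq sum_distrib_right)
  also have "\<dots> = (\<Sum>(s, a)\<in>Sigma (?P m) ?P. ?f a * ?g (s - a) * ?h (m - s))"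
    by (subst sum.Sigma) (auto simp: finite_submultisets)
  also have "\<dots> = (\<Sum>(a, b)\<in>Sigma (?P m) (\<lambda>a. ?P (m - a)). ?f a * (?g b * ?h (m - a - b)))"
    by (rule sum.reindex_bij_witness[where i = "\<lambda>(a, b). (a + b, a)" and j = "\<lambda>(s, a). (a, s - a)"])
       (auto simp: mult.assoc subset_eq_diff_conv subset_mset.le_diff_conv2 add.commute
             elim: subset_mset.order_trans)
  also have "\<dots> = (\<Sum>a\<in>?P m. \<Sum>b\<in>?P (m - a). ?f a * (?g b * ?h (m - a - b)))"
    by (subst sum.Sigma) (auto simp: finite_submultisets)
  also have "\<dots> = mps_coeff (f * (g * h)) m"
    by (simp add: times_mps.rep_eq sum_distrib_left)
  finally show "mps_coeff (f * g * h) m = mps_coeff (f * (g * h)) m" .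
qed

lemma mps_mult_commute:
  fixes f g :: "('v, 'a::comm_ring_1) mps"
  shows "f * g = g * f"
proof (rule mps_eqI)
  fix m :: "'v multiset"
  have inv: "m - (m - a) = a" if "a \<subseteq># m" for a
    using that by (simp add: multiset_eq_iff subseteq_mset_def)
  show "mps_coeff (f * g) m = mps_coeff (g * f) m"
    unfolding times_mps.rep_eq
    by (rule sum.reindex_bij_witness[where i = "\<lambda>a. m - a" and j = "\<lambda>a. m - a"])
       (auto simp: mult.commute inv)
qed

lemma mps_one_mult:
  fixes f :: "('v, 'a::comm_ring_1) mps"
  shows "1 * f = f"
proof (rule mps_eqI)
  fix m :: "'v multiset"
  have "mps_coeff (1 * f) m = (\<Sum>a\<in>{a. a \<subseteq># m}. if a = {#} then mps_coeff f m else 0)"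
    unfolding times_mps.rep_eq one_mps.rep_eq by (rule sum.cong) auto
  then show "mps_coeff (1 * f) m = mps_coeff f m"
    by (simp add: finite_submultisets)
qed

instance mps :: (type, comm_ring_1) comm_ring_1
proof
  fix f g h :: "('a, 'b) mps"
  show "f + g + h = f + (g + h)" by (rule mps_eqI) (simp add: plus_mps.rep_eq add.assoc)
  show "f + g = g + f" by (rule mps_eqI) (simp add: plus_mps.rep_eq add.commute)
  show "0 + f = f" by (rule mps_eqI) (simp add: plus_mps.rep_eq zero_mps.rep_eq)
  show "- f + f = 0"
    by (rule mps_eqI) (simp add: plus_mps.rep_eq zero_mps.rep_eq uminus_mps.rep_eq)
  show "f - g = f + - g"
    by (rule mps_eqI) (simp add: plus_mps.rep_eq minus_mps.rep_eq uminus_mps.rep_eq)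
  show "f * g * h = f * (g * h)" by (rule mps_mult_assoc)
  show "f * g = g * f" by (rule mps_mult_commute)
  show "1 * f = f" by (rule mps_one_mult)
  show "(f + g) * h = f * h + g * h"
    by (rule mps_eqI) (simp add: plus_mps.rep_eq times_mps.rep_eq distrib_right sum.distrib)
  have "mps_coeff (0 :: ('a, 'b) mps) {#} \<noteq> mps_coeff 1 {#}"
    by (simp add: zero_mps.rep_eq one_mps.rep_eq)
  then show "(0 :: ('a, 'b) mps) \<noteq> 1" by metis
qed

lift_definition mps_const :: "'a::zero \<Rightarrow> ('v, 'a) mps" is "\<lambda>c m. if m = {#} then c else 0" .

lift_definition mps_var :: "'v \<Rightarrow> ('v, 'a::{zero,one}) mps" is "\<lambda>v m. if m = {#v#} then 1 else 0" .

text \<open>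
  The sum of a family of series, taken coefficient by coefficient. It is meaningful when each
  monomial has a nonzero coefficient in only finitely many members of the family, which is the
  case for every family to which it is applied below.
\<close>

lift_definition mps_sum :: "('i \<Rightarrow> ('v, 'a::comm_monoid_add) mps) \<Rightarrow> 'i set \<Rightarrow> ('v, 'a) mps"
  is "\<lambda>f S m. \<Sum>s\<in>{s \<in> S. f s m \<noteq> 0}. f s m" .

text \<open>
  Symmetric functions live in the power series in \<open>z\<^sub>1, z\<^sub>2, \<dots>\<close> over the rationals (the index
  \<open>0\<close> is not used); the variables \<open>x\<^sub>1, \<dots>, x\<^sub>n\<close> are adjoined on top of these.
\<close>

type_synonym zseries = "(nat, rat) mps"
type_synonym xseries = "(nat, zseries) mps"

abbreviation Z :: "nat \<Rightarrow> zseries" where "Z \<equiv> mps_var"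

definition h_sym :: "nat \<Rightarrow> zseries" where
  "h_sym j = mps_sum (\<lambda>i. \<Prod>r=1..j. Z (i r)) {i \<in> {1..j} \<rightarrow>\<^sub>E {1..}. mono_on {1..j} i}"

definition e_sym :: "nat \<Rightarrow> zseries" where
  "e_sym j = mps_sum (\<lambda>i. \<Prod>r=1..j. Z (i r)) {i \<in> {1..j} \<rightarrow>\<^sub>E {1..}. strict_mono_on {1..j} i}"

definition p_sym :: "nat \<Rightarrow> zseries" where
  "p_sym k = mps_sum (\<lambda>i. Z i ^ k) {1..}"

definition F_qsym :: "nat \<Rightarrow> nat set \<Rightarrow> zseries" where
  "F_qsym n J = mps_sum (\<lambda>i. \<Prod>r=1..n. Z (i r))
     {i \<in> {1..n} \<rightarrow>\<^sub>E {1..}. mono_on {1..n} i \<and> (\<forall>j\<in>J. i j < i (j + 1))}"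

definition Des :: "nat \<Rightarrow> (nat \<times> nat) set \<Rightarrow> (nat \<Rightarrow> nat) \<Rightarrow> nat set" where
  "Des n E \<pi> = {i \<in> {1..n-1}. (\<pi> i, \<pi> (i + 1)) \<in> E}"

definition redei_berge :: "nat \<Rightarrow> (nat \<times> nat) set \<Rightarrow> zseries" where
  "redei_berge n E = (\<Sum>\<pi> | \<pi> permutes {1..n}. F_qsym n (Des n E \<pi>))"

definition p_cyc :: "nat set \<Rightarrow> (nat \<Rightarrow> nat) \<Rightarrow> zseries" where
  "p_cyc S \<sigma> = (\<Prod>c\<in>orbit \<sigma> ` S. p_sym (card c))"

text \<open>
  Matrix rows and columns are numbered from \<open>0\<close> in the library, so vertex \<open>i\<close> of \<open>{1..n}\<close>
  corresponds to row and column \<open>i - 1\<close>.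
\<close>

definition entry :: "'a mat \<Rightarrow> nat \<Rightarrow> nat \<Rightarrow> 'a" where
  "entry M i j = M $$ (i - 1, j - 1)"

definition adjacency_mat :: "nat \<Rightarrow> (nat \<times> nat) set \<Rightarrow> 'a::comm_ring_1 mat" where
  "adjacency_mat n E = mat n n (\<lambda>(i, j). if (i + 1, j + 1) \<in> E then 1 else 0)"

definition co_adjacency_mat :: "nat \<Rightarrow> (nat \<times> nat) set \<Rightarrow> 'a::comm_ring_1 mat" where
  "co_adjacency_mat n E = mat n n (\<lambda>_. 1) - adjacency_mat n E"

definition X_mat :: "nat \<Rightarrow> xseries mat" where
  "X_mat n = mat_diag n (\<lambda>i. mps_var (i + 1))"

definition trace_mat :: "'a::comm_monoid_add mat \<Rightarrow> 'a" where
  "trace_mat M = sum_list (diag_mat M)"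

definition H_mat :: "xseries mat \<Rightarrow> xseries mat" where
  "H_mat M = mat (dim_row M) (dim_col M)
     (\<lambda>ab. mps_sum (\<lambda>j. mps_const (h_sym j) * (M ^\<^sub>m j) $$ ab) UNIV)"

definition E_mat :: "xseries mat \<Rightarrow> xseries mat" where
  "E_mat M = mat (dim_row M) (dim_col M)
     (\<lambda>ab. mps_sum (\<lambda>j. mps_const (e_sym j) * (M ^\<^sub>m j) $$ ab) UNIV)"

definition mps_exp :: "xseries \<Rightarrow> xseries" where
  "mps_exp f = mps_sum (\<lambda>j. mps_const (mps_const (1 / fact j)) * f ^ j) UNIV"

definition multilinear_coeff :: "nat \<Rightarrow> xseries \<Rightarrow> zseries" where
  "multilinear_coeff n f = mps_coeff f (mset_set {1..n})"

end

theory Submission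
  imports Defs "HOL-Combinatorics.Multiset_Permutations" "HOL-Combinatorics.Cycles"
begin

text \<open>
  Let \<open>euler\<close> multiply each \<open>x\<close>-monomial by its degree, and put
  \<open>\<Phi> = \<Sum>\<^sub>k p\<^sub>k (tr (X A')\<^sup>k + (-1)\<^sup>k\<^sup>-\<^sup>1 tr (X A)\<^sup>k)\<close>, where \<open>A'\<close> is the complement of \<open>A\<close>. A series with
  constant term 1 and \<open>euler F = \<Phi> F\<close> is unique, so it suffices to find such a series behind each
  expression. For the determinants this is Jacobi's formula combined with Newton's identities; for
  the exponential it is the chain rule; for the sum over permutations (at square-free monomials) one
  marks a point and splits off its cycle.

  For \<open>\<U>\<^sub>D\<close> itself, let \<open>H\<close> be the generating series of all words, each weighted by the product of the
  entries of \<open>A'\<close> over its consecutive letters. Collecting equal indices \<open>i\<^sub>j\<close> shows that \<open>\<U>\<^sub>D\<close> is the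
  multilinear coefficient of the product over \<open>i\<close> of the series \<open>H\<close> with all variables scaled by \<open>z\<^sub>i\<close>.
  So one needs \<open>euler H = K H\<close> with \<open>K = \<Sum>\<^sub>k (tr (X A')\<^sup>k + (-1)\<^sup>k\<^sup>-\<^sup>1 tr (X A)\<^sup>k)\<close>. Since the entries of
  \<open>A\<close> and \<open>A'\<close> add up to 1, replacing the steps of a closed walk one after the other telescopes, each
  replacement leaving one unconstrained step at which the closed walk is cut open. In the product
  with \<open>H\<close> the step between the two factors is unconstrained as well, and the sum telescopes again.
\<close>

section \<open>Multivariate power series\<close>

lemmas mps_coeff_simps =
  zero_mps.rep_eq one_mps.rep_eq plus_mps.rep_eq minus_mps.rep_eq uminus_mps.rep_eq

lemma mps_coeff_sum: "mps_coeff (sum f A) m = (\<Sum>i\<in>A. mps_coeff (f i) m)"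
  for f :: "'i \<Rightarrow> ('v, 'a::comm_ring_1) mps"
  by (induction A rule: infinite_finite_induct) (simp_all add: mps_coeff_simps)

lemma mps_coeff_const_mult [simp]: "mps_coeff (mps_const c * f) m = c * mps_coeff f m"
  for f :: "('v, 'a::comm_ring_1) mps"
proof -
  have "mps_coeff (mps_const c * f) m = (\<Sum>a\<in>{a. a \<subseteq># m}. if a = {#} then c * mps_coeff f m else 0)"
    unfolding times_mps.rep_eq mps_const.rep_eq by (rule sum.cong) auto
  then show ?thesis by (simp add: finite_submultisets)
qed

lemma mps_const_mult: "mps_const (a * b) = mps_const a * (mps_const b :: ('v, 'a::comm_ring_1) mps)"
  by (rule mps_eqI) (simp add: mps_const.rep_eq)

lemma mps_const_add: "mps_const (a + b) = mps_const a + (mps_const b :: ('v, 'a::comm_ring_1) mps)"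
  by (rule mps_eqI) (simp add: mps_const.rep_eq mps_coeff_simps)

lemma mps_const_0 [simp]: "mps_const 0 = (0 :: ('v, 'a::comm_ring_1) mps)"
  by (rule mps_eqI) (simp add: mps_const.rep_eq mps_coeff_simps)

lemma mps_const_1 [simp]: "mps_const 1 = (1 :: ('v, 'a::comm_ring_1) mps)"
  by (rule mps_eqI) (simp add: mps_const.rep_eq mps_coeff_simps)

lemma mps_const_uminus: "mps_const (- a) = - (mps_const a :: ('v, 'a::comm_ring_1) mps)"
  by (rule mps_eqI) (simp add: mps_const.rep_eq mps_coeff_simps)

lemma mps_const_sum: "mps_const (sum f A) = (\<Sum>i\<in>A. mps_const (f i) :: ('v, 'a::comm_ring_1) mps)"
  by (induction A rule: infinite_finite_induct) (simp_all add: mps_const_add)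

lemma mps_const_prod: "mps_const (prod f A) = (\<Prod>i\<in>A. mps_const (f i) :: ('v, 'a::comm_ring_1) mps)"
  by (induction A rule: infinite_finite_induct) (simp_all add: mps_const_mult)

lemma mps_const_power: "mps_const (a ^ k) = (mps_const a :: ('v, 'a::comm_ring_1) mps) ^ k"
  by (induction k) (simp_all add: mps_const_mult)

lemma mps_const_of_nat: "mps_const (of_nat k) = (of_nat k :: ('v, 'a::comm_ring_1) mps)"
  by (induction k) (simp_all add: mps_const_add)

lemma mps_coeff_of_nat_mult [simp]: "mps_coeff (of_nat k * f) m = of_nat k * mps_coeff f m"
  for f :: "('v, 'a::comm_ring_1) mps"
  by (simp flip: mps_const_of_nat)

text \<open>\<open>mps_sum\<close> adds up the members with nonzero coefficient at \<open>m\<close>,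
  and an infinite such sum defaults to 0. Enclosing these members in a finite \<open>A\<close>
  excludes this and only adds zero terms.\<close>

lemma mps_coeff_sum_family:
  fixes f :: "'i \<Rightarrow> ('v, 'a::comm_monoid_add) mps"
  assumes "finite A" "A \<subseteq> S" "\<And>s. s \<in> S \<Longrightarrow> s \<notin> A \<Longrightarrow> mps_coeff (f s) m = 0"
  shows "mps_coeff (mps_sum f S) m = (\<Sum>s\<in>A. mps_coeff (f s) m)"
  unfolding mps_sum.rep_eq by (rule sum.mono_neutral_left) (use assms in auto)

lemma mps_coeff_mult_empty [simp]: "mps_coeff (f * g) {#} = mps_coeff f {#} * mps_coeff g {#}"
  for f g :: "('v, 'a::comm_ring_1) mps"
  by (simp add: times_mps.rep_eq)

subsection \<open>The Euler operator\<close>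

lift_definition euler :: "('v, 'a::comm_ring_1) mps \<Rightarrow> ('v, 'a) mps"
  is "\<lambda>f m. of_nat (size m) * f m" .

text \<open>Leibniz rule: when a monomial is split into two factors, their degrees add up.\<close>

lemma euler_mult: "euler (f * g) = euler f * g + f * euler g"
proof (rule mps_eqI)
  fix m :: "'a multiset"
  have "mps_coeff (euler (f * g)) m
      = (\<Sum>a\<in>{a. a \<subseteq># m}. of_nat (size m) * (mps_coeff f a * mps_coeff g (m - a)))"
    by (simp add: euler.rep_eq times_mps.rep_eq sum_distrib_left)
  also have "\<dots> = (\<Sum>a\<in>{a. a \<subseteq># m}. of_nat (size a) * mps_coeff f a * mps_coeff g (m - a)
      + mps_coeff f a * (of_nat (size (m - a)) * mps_coeff g (m - a)))"
  proof (rule sum.cong[OF refl])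
    fix a assume "a \<in> {a. a \<subseteq># m}"
    then have "size m = size a + size (m - a)"
      by (metis mem_Collect_eq size_union subset_mset.add_diff_inverse)
    then show "of_nat (size m) * (mps_coeff f a * mps_coeff g (m - a))
      = of_nat (size a) * mps_coeff f a * mps_coeff g (m - a)
      + mps_coeff f a * (of_nat (size (m - a)) * mps_coeff g (m - a))"
      by (simp add: algebra_simps)
  qed
  also have "\<dots> = mps_coeff (euler f * g + f * euler g) m"
    by (simp add: euler.rep_eq times_mps.rep_eq mps_coeff_simps sum.distrib)
  finally show "mps_coeff (euler (f * g)) m = mps_coeff (euler f * g + f * euler g) m" .
qed

lemma euler_add: "euler (f + g) = euler f + euler g"
  by (rule mps_eqI) (simp add: euler.rep_eq mps_coeff_simps algebra_simps)

lemma euler_0 [simp]: "euler 0 = 0"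
  by (rule mps_eqI) (simp add: euler.rep_eq mps_coeff_simps)

lemma euler_1 [simp]: "euler 1 = 0"
  by (rule mps_eqI) (simp add: euler.rep_eq mps_coeff_simps)

lemma euler_sum: "euler (sum f A) = (\<Sum>i\<in>A. euler (f i))"
  by (induction A rule: infinite_finite_induct) (simp_all add: euler_add)

lemma euler_const_mult: "euler (mps_const c * f) = mps_const c * euler f"
  by (rule mps_eqI) (simp add: euler.rep_eq)

lemma euler_of_int_mult: "euler (of_int c * f) = of_int c * euler f"
proof -
  have "euler (of_nat k * f) = of_nat k * euler f" for k
    by (rule mps_eqI) (simp add: euler.rep_eq)
  moreover have "euler (- g) = - euler g" for g :: "('a, 'b) mps"
    by (rule mps_eqI) (simp add: euler.rep_eq mps_coeff_simps)
  ultimately show ?thesis by (cases c rule: int_cases2) auto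
qed

lemma euler_prod:
  assumes "finite A"
  shows "euler (prod f A) = (\<Sum>i\<in>A. euler (f i) * prod f (A - {i}))"
  using assms
proof induction
  case (insert x A)
  have "f x * prod f (A - {i}) = prod f (insert x A - {i})" if "i \<in> A" for i
  proof -
    have "insert x A - {i} = insert x (A - {i})" using insert that by auto
    then show ?thesis using insert by simp
  qed
  then have "euler (f i) * prod f (insert x A - {i}) = f x * (euler (f i) * prod f (A - {i}))"
    if "i \<in> A" for i
    using that by (metis mult.left_commute)
  then have *: "(\<Sum>i\<in>A. euler (f i) * prod f (insert x A - {i})) = f x * (\<Sum>i\<in>A. euler (f i) * prod f (A - {i}))"
    unfolding sum_distrib_left by (intro sum.cong) auto
  have "insert x A - {x} = A" using insert by auto
  with insert show ?case by (simp add: euler_mult *)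
qed simp

lemma euler_power: "euler (f ^ Suc k) = of_nat (Suc k) * (euler f * f ^ k)"
  by (induction k) (simp_all add: euler_mult algebra_simps)

text \<open>
  Restricted to the divisors of \<open>M\<close>, because the permutation sums satisfy the differential equation
  at square-free monomials only.
\<close>

lemma euler_solution_unique:
  fixes \<Phi> F G :: "('v, ('w, rat) mps) mps"
  assumes \<Phi>: "mps_coeff \<Phi> {#} = 0" and FG: "mps_coeff F {#} = mps_coeff G {#}"
    and F: "\<And>m. m \<subseteq># M \<Longrightarrow> mps_coeff (euler F) m = mps_coeff (\<Phi> * F) m"
    and G: "\<And>m. m \<subseteq># M \<Longrightarrow> mps_coeff (euler G) m = mps_coeff (\<Phi> * G) m"
  shows "m \<subseteq># M \<Longrightarrow> mps_coeff F m = mps_coeff G m"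
proof (induction "size m" arbitrary: m rule: less_induct)
  case less
  show ?case
  proof (cases "m = {#}")
    case False
    \<comment> \<open>As \<Phi> has no constant term, the product at \<open>m\<close> involves
      \<open>F\<close> and \<open>G\<close> only at monomials of smaller degree, where they agree by
      induction.\<close>
    have "mps_coeff \<Phi> a * mps_coeff F (m - a) = mps_coeff \<Phi> a * mps_coeff G (m - a)" if "a \<subseteq># m" for a
    proof (cases "a = {#}")
      case False
      then have "size (m - a) < size m"
        using that by (metis diff_empty diff_subset_eq_self mset_subset_size nonempty_has_size
            size_Diff_submset size_mset_mono subset_mset.less_le zero_less_diff diff_less order_less_le_trans)
      then have "mps_coeff F (m - a) = mps_coeff G (m - a)"
        by (rule less.hyps[OF _ subset_mset.order_trans[OF diff_subset_eq_self less.prems]])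
      then show ?thesis by simp
    qed (simp add: \<Phi>)
    then have "mps_coeff (\<Phi> * F) m = mps_coeff (\<Phi> * G) m"
      unfolding times_mps.rep_eq by (intro sum.cong) auto
    then have *: "of_nat (size m) * mps_coeff F m = of_nat (size m) * mps_coeff G m"
      using F[OF less.prems] G[OF less.prems] by (simp add: euler.rep_eq)
    \<comment> \<open>The degree is cancelled in the rational coefficients of the inner series,
      because the inner series themselves only form a ring.\<close>
    show ?thesis
    proof (rule mps_eqI)
      fix z
      show "mps_coeff (mps_coeff F m) z = mps_coeff (mps_coeff G m) z"
        using arg_cong[OF *, of "\<lambda>f. mps_coeff f z"] False by simp
    qed
  qed (simp add: FG)
qed

subsection \<open>Homogeneous families\<close>

definition homogeneous :: "nat \<Rightarrow> ('v, 'a::zero) mps \<Rightarrow> bool" where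
  "homogeneous k f \<longleftrightarrow> (\<forall>m. mps_coeff f m \<noteq> 0 \<longrightarrow> size m = k)"

text \<open>In a homogeneous family only the member whose index is the degree of the monomial can
  contribute. Reading off that one coefficient gives the sum of the family without any finiteness
  condition.\<close>

lift_definition graded_sum :: "(nat \<Rightarrow> ('v, 'a) mps) \<Rightarrow> ('v, 'a) mps" is "\<lambda>f m. f (size m) m" .

lemma homogeneous_mult:
  fixes f g :: "('v, 'a::comm_ring_1) mps"
  assumes "homogeneous j f" "homogeneous k g"
  shows "homogeneous (j + k) (f * g)"
  unfolding homogeneous_def
proof (intro allI impI)
  fix m assume "mps_coeff (f * g) m \<noteq> 0"
  then obtain a where a: "a \<subseteq># m" "mps_coeff f a \<noteq> 0" "mps_coeff g (m - a) \<noteq> 0"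
    unfolding times_mps.rep_eq by (metis (mono_tags, lifting) mem_Collect_eq mult_not_zero sum.not_neutral_contains_not_neutral)
  then have "size a = j" "size (m - a) = k" using assms by (auto simp: homogeneous_def)
  then show "size m = j + k" using a(1) by (metis size_union subset_mset.add_diff_inverse)
qed

lemma homogeneous_sum:
  fixes f :: "'i \<Rightarrow> ('v, 'a::comm_ring_1) mps"
  assumes "\<And>i. i \<in> A \<Longrightarrow> homogeneous k (f i)"
  shows "homogeneous k (sum f A)"
  using assms unfolding homogeneous_def mps_coeff_sum
  by (metis (mono_tags, lifting) sum.not_neutral_contains_not_neutral)

lemma homogeneous_const_mult:
  "homogeneous k f \<Longrightarrow> homogeneous k (mps_const c * f)" for f :: "('v, 'a::comm_ring_1) mps"
  by (auto simp: homogeneous_def) (metis mult_zero_right)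

lemma mps_sum_homogeneous:
  fixes f :: "nat \<Rightarrow> ('v, 'a::comm_ring_1) mps"
  assumes "\<And>k. k \<in> S \<Longrightarrow> homogeneous k (f k)"
  shows "mps_sum f S = graded_sum (\<lambda>k. if k \<in> S then f k else 0)"
proof (rule mps_eqI)
  fix m
  show "mps_coeff (mps_sum f S) m = mps_coeff (graded_sum (\<lambda>k. if k \<in> S then f k else 0)) m"
  proof (cases "size m \<in> S")
    case True
    then have "mps_coeff (mps_sum f S) m = (\<Sum>s\<in>{size m}. mps_coeff (f s) m)"
      using assms by (intro mps_coeff_sum_family) (auto simp: homogeneous_def)
    with True show ?thesis by (simp add: graded_sum.rep_eq)
  next
    case False
    then have "mps_coeff (mps_sum f S) m = (\<Sum>s\<in>{}. mps_coeff (f s) m)"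
      using assms by (intro mps_coeff_sum_family) (auto simp: homogeneous_def)
    with False show ?thesis by (simp add: graded_sum.rep_eq zero_mps.rep_eq)
  qed
qed

text \<open>For a fixed splitting of a monomial into \<open>a\<close> and its cofactor, homogeneity
  leaves only the term \<open>j = size a\<close> of the convolution.\<close>

lemma graded_sum_mult:
  fixes f g :: "nat \<Rightarrow> ('v, 'a::comm_ring_1) mps"
  assumes "\<And>k. homogeneous k (f k)" "\<And>k. homogeneous k (g k)"
  shows "graded_sum f * graded_sum g = graded_sum (\<lambda>k. \<Sum>j\<le>k. f j * g (k - j))"
proof (rule mps_eqI)
  fix m :: "'v multiset"
  have "(\<Sum>j\<le>size m. mps_coeff (f j) a * mps_coeff (g (size m - j)) (m - a))
      = mps_coeff (f (size a)) a * mps_coeff (g (size (m - a))) (m - a)" if "a \<subseteq># m" for a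
  proof -
    have sz: "size (m - a) = size m - size a" "size a \<le> size m"
      using that by (auto simp: size_Diff_submset size_mset_mono)
    have "(\<Sum>j\<le>size m. mps_coeff (f j) a * mps_coeff (g (size m - j)) (m - a))
        = (\<Sum>j\<in>{size a}. mps_coeff (f j) a * mps_coeff (g (size m - j)) (m - a))"
    proof (rule sum.mono_neutral_right)
      have "mps_coeff (f j) a = 0" if "j \<noteq> size a" for j
        using assms(1)[of j] that by (auto simp: homogeneous_def)
      then show "\<forall>j\<in>{..size m} - {size a}. mps_coeff (f j) a * mps_coeff (g (size m - j)) (m - a) = 0"
        by simp
    qed (use sz in auto)
    then show ?thesis by (simp add: sz)
  qed
  then show "mps_coeff (graded_sum f * graded_sum g) m
      = mps_coeff (graded_sum (\<lambda>k. \<Sum>j\<le>k. f j * g (k - j))) m"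
    unfolding times_mps.rep_eq graded_sum.rep_eq mps_coeff_sum
    by (subst sum.swap) (auto intro: sum.cong)
qed

lemma sum_graded_sum:
  "(\<Sum>i\<in>A. graded_sum (f i)) = graded_sum (\<lambda>k. \<Sum>i\<in>A. f i k :: ('v, 'a::comm_ring_1) mps)"
  by (rule mps_eqI) (simp add: mps_coeff_sum graded_sum.rep_eq)

lemma euler_graded_sum:
  "euler (graded_sum f) = graded_sum (\<lambda>k. of_nat k * f k)"
  by (rule mps_eqI) (simp add: euler.rep_eq graded_sum.rep_eq)

section \<open>Determinants of matrix power series\<close>

text \<open>The Leibniz rule differentiates one row at a time. The matrix \<open>B i\<close> is
  \<open>A\<close> with row \<open>i\<close> differentiated; expanding its determinant along that
  row gives cofactors of \<open>A\<close>, which do not see row \<open>i\<close>.\<close>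

lemma euler_det:
  fixes A :: "('v, 'a::comm_ring_1) mps mat"
  assumes A: "A \<in> carrier_mat n n"
  shows "euler (det A) = (\<Sum>i<n. \<Sum>j<n. euler (A $$ (i, j)) * cofactor A i j)"
proof -
  define B where "B i = mat n n (\<lambda>(i', j). if i' = i then euler (A $$ (i, j)) else A $$ (i', j))" for i
  have prodB: "euler (A $$ (i, p i)) * (\<Prod>k\<in>{0..<n} - {i}. A $$ (k, p k)) = (\<Prod>k = 0..<n. B i $$ (k, p k))"
    if "i < n" "p permutes {0..<n}" for i p
  proof -
    have p: "p k < n" if "k < n" for k
      using \<open>p permutes {0..<n}\<close> that by (metis atLeastLessThan_iff permutes_in_image zero_le)
    have "(\<Prod>k = 0..<n. B i $$ (k, p k)) = B i $$ (i, p i) * (\<Prod>k\<in>{0..<n} - {i}. B i $$ (k, p k))"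
      using \<open>i < n\<close> by (intro prod.remove) auto
    also have "(\<Prod>k\<in>{0..<n} - {i}. B i $$ (k, p k)) = (\<Prod>k\<in>{0..<n} - {i}. A $$ (k, p k))"
      by (intro prod.cong) (auto simp: B_def p)
    finally show ?thesis using \<open>i < n\<close> by (simp add: B_def p)
  qed
  have B: "B i \<in> carrier_mat n n" for i by (simp add: B_def)
  have "euler (det A) = (\<Sum>p | p permutes {0..<n}. signof p * (\<Sum>i=0..<n.
      euler (A $$ (i, p i)) * (\<Prod>k\<in>{0..<n} - {i}. A $$ (k, p k))))"
    unfolding det_def'[OF A] euler_sum euler_of_int_mult by (simp add: euler_prod)
  also have "\<dots> = (\<Sum>p | p permutes {0..<n}. \<Sum>i=0..<n. signof p * (\<Prod>k = 0..<n. B i $$ (k, p k)))"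
    unfolding sum_distrib_left by (intro sum.cong refl) (simp add: prodB)
  also have "\<dots> = (\<Sum>i=0..<n. det (B i))"
    unfolding det_def'[OF B] by (rule sum.swap)
  also have "\<dots> = (\<Sum>i=0..<n. \<Sum>j<n. euler (A $$ (i, j)) * cofactor A i j)"
  proof (intro sum.cong refl)
    fix i assume "i \<in> {0..<n}"
    then have i: "i < n" by simp
    have "det (B i) = (\<Sum>j<n. B i $$ (i, j) * cofactor (B i) i j)"
      by (rule laplace_expansion_row[OF B i])
    also have "\<dots> = (\<Sum>j<n. euler (A $$ (i, j)) * cofactor A i j)"
    proof (intro sum.cong refl)
      fix j assume "j \<in> {..<n}"
      moreover have "mat_delete (B i) i j = mat_delete A i j"
        unfolding mat_delete_def using A i by (auto simp: B_def)
      ultimately show "B i $$ (i, j) * cofactor (B i) i j = euler (A $$ (i, j)) * cofactor A i j"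
        using i by (simp add: B_def cofactor_def)
    qed
    finally show "det (B i) = (\<Sum>j<n. euler (A $$ (i, j)) * cofactor A i j)" .
  qed
  finally show ?thesis by (simp add: atLeast0LessThan)
qed

lemma trace_mat_sum: "M \<in> carrier_mat n n \<Longrightarrow> trace_mat M = (\<Sum>i<n. M $$ (i, i))"
  by (simp add: trace_mat_def diag_mat_def sum_list_sum_nth atLeast0LessThan)

text \<open>Jacobi's formula without inverting \<open>C\<close>: after inserting
  \<open>Q * C\<close> into \<open>euler_det\<close>, the sums over \<open>j\<close> are entries of
  \<open>C\<close> times its adjugate. These vanish off the diagonal, so only the trace of
  \<open>Q\<close> survives.\<close>

lemma euler_det_logarithmic:
  fixes C Q :: "('v, 'a::comm_ring_1) mps mat"
  assumes C: "C \<in> carrier_mat n n" and Q: "Q \<in> carrier_mat n n"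
    and CQ: "map_mat euler C = Q * C"
  shows "euler (det C) = trace_mat Q * det C"
proof -
  have entry: "euler (C $$ (i, j)) = (\<Sum>l<n. Q $$ (i, l) * C $$ (l, j))" if "i < n" "j < n" for i j
  proof -
    have "euler (C $$ (i, j)) = map_mat euler C $$ (i, j)" using C that by simp
    then show ?thesis using C Q that by (simp add: CQ scalar_prod_def atLeast0LessThan)
  qed
  have adj: "(\<Sum>j<n. C $$ (l, j) * cofactor C i j) = (if l = i then det C else 0)"
    if "l < n" "i < n" for l i
  proof -
    have "(\<Sum>j<n. C $$ (l, j) * cofactor C i j) = (C * adj_mat C) $$ (l, i)"
      using C that by (simp add: adj_mat_def scalar_prod_def atLeast0LessThan)
    then show ?thesis using that by (simp add: adj_mat(2)[OF C])
  qed
  have "euler (det C) = (\<Sum>i<n. \<Sum>j<n. \<Sum>l<n. Q $$ (i, l) * (C $$ (l, j) * cofactor C i j))"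
    unfolding euler_det[OF C] by (intro sum.cong refl) (simp add: entry sum_distrib_right mult.assoc)
  also have "\<dots> = (\<Sum>i<n. \<Sum>l<n. Q $$ (i, l) * (\<Sum>j<n. C $$ (l, j) * cofactor C i j))"
    unfolding sum_distrib_left by (intro sum.cong refl sum.swap)
  also have "\<dots> = (\<Sum>i<n. \<Sum>l<n. if l = i then Q $$ (i, i) * det C else 0)"
    by (intro sum.cong refl) (simp add: adj)
  also have "\<dots> = trace_mat Q * det C"
    by (simp add: trace_mat_sum[OF Q] sum_distrib_right)
  finally show ?thesis .
qed

text \<open>Intended for a matrix \<open>M\<close> of linear forms: its \<open>j\<close>-th power
  then has degree \<open>j\<close>, and \<open>graded_sum\<close> is the power series in
  \<open>M\<close> with coefficients \<open>c\<close>.\<close>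

definition mat_series :: "(nat \<Rightarrow> 'a) \<Rightarrow> ('v, 'a::comm_ring_1) mps mat \<Rightarrow> ('v, 'a) mps mat" where
  "mat_series c M = mat (dim_row M) (dim_col M)
     (\<lambda>ab. graded_sum (\<lambda>j. mps_const (c j) * (M ^\<^sub>m j) $$ ab))"

lemma pow_mat_add:
  fixes M :: "'a::comm_ring_1 mat"
  assumes "M \<in> carrier_mat n n"
  shows "M ^\<^sub>m (i + j) = M ^\<^sub>m i * M ^\<^sub>m j"
proof (induction j)
  case (Suc j)
  then show ?case using assms by (simp add: assoc_mult_mat[of _ n n _ n _ n])
qed (use assms in \<open>simp add: right_mult_one_mat[of _ n n]\<close>)

lemma homogeneous_pow_mat:
  fixes M :: "('v, 'a::comm_ring_1) mps mat"
  assumes M: "M \<in> carrier_mat n n" and hom: "\<And>i j. i < n \<Longrightarrow> j < n \<Longrightarrow> homogeneous 1 (M $$ (i, j))"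
  shows "i < n \<Longrightarrow> j < n \<Longrightarrow> homogeneous k ((M ^\<^sub>m k) $$ (i, j))"
proof (induction k arbitrary: i j)
  case 0
  then show ?case using M by (auto simp: homogeneous_def mps_coeff_simps)
next
  case (Suc k)
  have "(M ^\<^sub>m Suc k) $$ (i, j) = (\<Sum>l<n. (M ^\<^sub>m k) $$ (i, l) * M $$ (l, j))"
    using M Suc.prems by (simp add: scalar_prod_def atLeast0LessThan)
  moreover have "homogeneous (k + 1) (\<Sum>l<n. (M ^\<^sub>m k) $$ (i, l) * M $$ (l, j))"
    using Suc hom by (intro homogeneous_sum homogeneous_mult) auto
  ultimately show ?case by simp
qed

lemma trace_mat_series:
  fixes M :: "('v, 'a::comm_ring_1) mps mat"
  assumes M: "M \<in> carrier_mat n n"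
  shows "trace_mat (mat_series q M) = graded_sum (\<lambda>k. mps_const (q k) * trace_mat (M ^\<^sub>m k))"
proof -
  have 1: "mat_series q M \<in> carrier_mat n n" using M by (simp add: mat_series_def)
  have 2: "M ^\<^sub>m k \<in> carrier_mat n n" for k using M by simp
  show ?thesis
    unfolding trace_mat_sum[OF 1] trace_mat_sum[OF 2] sum_distrib_left
    using M by (simp add: mat_series_def flip: sum_graded_sum)
qed

text \<open>The hypothesis \<open>newton\<close> says that the one-variable series with coefficients
  \<open>c\<close> has logarithmic Euler derivative \<open>q\<close>. Substituting \<open>M\<close>
  for the variable keeps this relation, since powers of \<open>M\<close> multiply by adding
  exponents and the \<open>j\<close>-th power has degree \<open>j\<close>. Jacobi's formula then
  applies.\<close>

lemma det_mat_series:
  fixes M :: "('v, 'a::comm_ring_1) mps mat"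
  assumes M: "M \<in> carrier_mat n n" and hom: "\<And>i j. i < n \<Longrightarrow> j < n \<Longrightarrow> homogeneous 1 (M $$ (i, j))"
    and newton: "\<And>j. of_nat j * c j = (\<Sum>k\<le>j. q k * c (j - k))"
  shows "euler (det (mat_series c M)) = trace_mat (mat_series q M) * det (mat_series c M)"
proof (rule euler_det_logarithmic)
  show C: "mat_series c M \<in> carrier_mat n n" and Q: "mat_series q M \<in> carrier_mat n n"
    using M by (auto simp: mat_series_def)
  note H = homogeneous_const_mult[OF homogeneous_pow_mat[OF M hom]]
  have "euler (mat_series c M $$ (a, b)) = (\<Sum>l<n. mat_series q M $$ (a, l) * mat_series c M $$ (l, b))"
    if "a < n" "b < n" for a b
  proof -
    have pow: "(\<Sum>l<n. (M ^\<^sub>m i) $$ (a, l) * (M ^\<^sub>m j) $$ (l, b)) = (M ^\<^sub>m (i + j)) $$ (a, b)" for i j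
      using M that by (simp add: pow_mat_add[OF M] scalar_prod_def atLeast0LessThan)
    have "(\<Sum>l<n. mat_series q M $$ (a, l) * mat_series c M $$ (l, b))
      = (\<Sum>l<n. graded_sum (\<lambda>k. \<Sum>j\<le>k. mps_const (q j) * (M ^\<^sub>m j) $$ (a, l)
           * (mps_const (c (k - j)) * (M ^\<^sub>m (k - j)) $$ (l, b))))"
    proof (intro sum.cong refl)
      fix l assume "l \<in> {..<n}"
      then show "mat_series q M $$ (a, l) * mat_series c M $$ (l, b)
        = graded_sum (\<lambda>k. \<Sum>j\<le>k. mps_const (q j) * (M ^\<^sub>m j) $$ (a, l)
           * (mps_const (c (k - j)) * (M ^\<^sub>m (k - j)) $$ (l, b)))"
        using M that H by (simp add: mat_series_def graded_sum_mult)
    qed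
    also have "\<dots> = graded_sum (\<lambda>k. \<Sum>j\<le>k. mps_const (q j * c (k - j)) *
        (\<Sum>l<n. (M ^\<^sub>m j) $$ (a, l) * (M ^\<^sub>m (k - j)) $$ (l, b)))"
      unfolding sum_graded_sum sum_distrib_left
      by (subst sum.swap) (simp add: mps_const_mult mult_ac)
    also have "\<dots> = graded_sum (\<lambda>k. \<Sum>j\<le>k. mps_const (q j * c (k - j)) * (M ^\<^sub>m k) $$ (a, b))"
      by (simp add: pow)
    also have "\<dots> = graded_sum (\<lambda>k. of_nat k * (mps_const (c k) * (M ^\<^sub>m k) $$ (a, b)))"
      unfolding sum_distrib_right[symmetric] mps_const_sum[symmetric] newton[symmetric]
      by (simp add: mps_const_mult mps_const_of_nat mult.assoc)
    also have "\<dots> = euler (mat_series c M $$ (a, b))"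
      using M that by (simp add: mat_series_def euler_graded_sum)
    finally show ?thesis by simp
  qed
  then show "map_mat euler (mat_series c M) = mat_series q M * mat_series c M"
    using C Q by (intro eq_matI) (auto simp: scalar_prod_def atLeast0LessThan)
qed

text \<open>Taking constant terms is a ring homomorphism, hence commutes with \<open>det\<close>,
  and it sends the matrix to the identity.\<close>

lemma det_mat_series_empty:
  fixes M :: "('v, 'a::comm_ring_1) mps mat"
  assumes M: "M \<in> carrier_mat n n" and c0: "c 0 = 1"
  shows "mps_coeff (det (mat_series c M)) {#} = 1"
proof -
  interpret h: comm_ring_hom "\<lambda>f :: ('v, 'a) mps. mps_coeff f {#}"
    by unfold_locales (simp_all add: mps_coeff_simps)
  have "map_mat (\<lambda>f. mps_coeff f {#}) (mat_series c M) = 1\<^sub>m n"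
    using M c0 by (intro eq_matI) (auto simp: mat_series_def graded_sum.rep_eq mps_coeff_simps)
  then show ?thesis by (metis h.hom_det det_one)
qed

section \<open>The exponential\<close>

lemma mps_coeff_power_eq_0:
  fixes f :: "('v, 'a::comm_ring_1) mps"
  assumes "mps_coeff f {#} = 0"
  shows "size m < j \<Longrightarrow> mps_coeff (f ^ j) m = 0"
proof (induction j arbitrary: m)
  case (Suc j)
  have "mps_coeff f a * mps_coeff (f ^ j) (m - a) = 0" if "a \<subseteq># m" for a
  proof (cases "a = {#}")
    case False
    then have "size (m - a) < size m"
      using that by (metis nonempty_has_size size_Diff_submset size_mset_mono diff_less order_less_le_trans)
    then show ?thesis using Suc by simp
  qed (simp add: assms)
  then show ?case by (simp add: times_mps.rep_eq)
qed simp

text \<open>Without a constant term, the power \<open>f ^ j\<close> starts in degree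
  \<open>j\<close>, so a truncation of the exponential is exact up to its order.\<close>

lemma mps_coeff_exp:
  assumes f: "mps_coeff f {#} = 0" and "size m \<le> L"
  shows "mps_coeff (mps_exp f) m = mps_coeff (\<Sum>j\<le>L. mps_const (mps_const (1 / fact j)) * f ^ j) m"
  unfolding mps_exp_def mps_coeff_sum
  using assms(2) by (intro mps_coeff_sum_family) (auto simp: mps_coeff_power_eq_0[OF f])

lemma mps_exp_empty: "mps_coeff f {#} = 0 \<Longrightarrow> mps_coeff (mps_exp f) {#} = 1"
  by (subst mps_coeff_exp[where L = 0]) (simp_all add: one_mps.rep_eq)

text \<open>Differentiating the truncation of order \<open>Suc L\<close> gives
  \<open>euler f\<close> times the truncation of order \<open>L\<close>. With \<open>L\<close> the
  degree of the monomial, both truncations are exact there.\<close>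

lemma euler_exp:
  assumes f: "mps_coeff f {#} = 0"
  shows "euler (mps_exp f) = euler f * mps_exp f"
proof (rule mps_eqI)
  fix m :: "nat multiset"
  define L where "L = size m"
  let ?e = "\<lambda>L. \<Sum>j\<le>L. mps_const (mps_const (1 / fact j)) * f ^ j"
  have scale: "mps_const (mps_const (1 / fact (Suc j))) * (of_nat (Suc j) * g) = mps_const (mps_const (1 / fact j)) * g"
    for j and g :: xseries
  proof -
    have "mps_const (mps_const (1 / fact (Suc j))) * of_nat (Suc j)
        = (mps_const (mps_const (1 / fact (Suc j) * of_nat (Suc j))) :: xseries)"
      unfolding mps_const_mult mps_const_of_nat ..
    also have "1 / fact (Suc j) * of_nat (Suc j) = (1 / fact j :: rat)" by (simp add: field_simps del: of_nat_Suc)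
    finally show ?thesis by (metis mult.assoc)
  qed
  have "euler (?e (Suc L)) = (\<Sum>j\<le>L. mps_const (mps_const (1 / fact (Suc j))) * euler (f ^ Suc j))"
    by (simp add: sum.atMost_Suc_shift euler_add euler_sum euler_const_mult del: sum.atMost_Suc power_Suc fact_Suc)
  also have "\<dots> = euler f * ?e L"
    unfolding euler_power scale by (simp add: sum_distrib_left mult.left_commute)
  finally have e: "euler (?e (Suc L)) = euler f * ?e L" .
  have "mps_coeff (euler (mps_exp f)) m = mps_coeff (euler (?e (Suc L))) m"
    by (simp add: euler.rep_eq mps_coeff_exp[OF f, of m "Suc L"] L_def del: sum.atMost_Suc)
  also have "\<dots> = mps_coeff (euler f * mps_exp f) m"
    unfolding e times_mps.rep_eq
    by (intro sum.cong refl) (simp add: L_def mps_coeff_exp[OF f, of _ L] size_mset_mono)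
  finally show "mps_coeff (euler (mps_exp f)) m = mps_coeff (euler f * mps_exp f) m" .
qed

section \<open>Series indexed by words\<close>

text \<open>The commutative image of a noncommutative generating series: the words over
  \<open>V\<close> with letter multiset \<open>s\<close> all contribute to the monomial
  \<open>s\<close>.\<close>

lift_definition word_series :: "'v set \<Rightarrow> ('v list \<Rightarrow> 'a::comm_ring_1) \<Rightarrow> ('v, 'a) mps"
  is "\<lambda>V \<phi> s. if set_mset s \<subseteq> V then \<Sum>w\<in>permutations_of_multiset s. \<phi> w else 0" .

lemma word_series_cong:
  assumes "\<And>w. set w \<subseteq> V \<Longrightarrow> \<phi> w = \<psi> w"
  shows "word_series V \<phi> = word_series V \<psi>"
proof (rule mps_eqI)
  fix s
  have "\<phi> w = \<psi> w" if "set_mset s \<subseteq> V" "w \<in> permutations_of_multiset s" for w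
    using that by (intro assms) (auto dest!: permutations_of_multisetD)
  then show "mps_coeff (word_series V \<phi>) s = mps_coeff (word_series V \<psi>) s"
    by (simp add: word_series.rep_eq)
qed

lemma length_permutations_of_multiset: "w \<in> permutations_of_multiset s \<Longrightarrow> length w = size s"
  by (metis permutations_of_multisetD size_mset)

text \<open>A pair of words is the same as one word with a cut position, and the cut determines how
  the letters are distributed over the two factors.\<close>

lemma word_series_mult:
  "word_series V \<phi> * word_series V \<psi>
    = word_series V (\<lambda>w. \<Sum>k\<le>length w. \<phi> (take k w) * \<psi> (drop k w))"
proof (rule mps_eqI)
  fix s :: "'a multiset"
  let ?P = "permutations_of_multiset :: 'a multiset \<Rightarrow> _"
  show "mps_coeff (word_series V \<phi> * word_series V \<psi>) s
    = mps_coeff (word_series V (\<lambda>w. \<Sum>k\<le>length w. \<phi> (take k w) * \<psi> (drop k w))) s"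
  proof (cases "set_mset s \<subseteq> V")
    case True
    have sub: "set_mset a \<subseteq> V" "set_mset (s - a) \<subseteq> V" if "a \<subseteq># s" for a
      using that True set_mset_mono[of a s] set_mset_mono[of "s - a" s] by auto
    have "mps_coeff (word_series V \<phi> * word_series V \<psi>) s
      = (\<Sum>a\<in>{a. a \<subseteq># s}. \<Sum>(u, v)\<in>?P a \<times> ?P (s - a). \<phi> u * \<psi> v)"
      unfolding times_mps.rep_eq
      by (intro sum.cong refl) (simp add: word_series.rep_eq sub sum_product sum.cartesian_product)
    also have "\<dots> = (\<Sum>(a, u, v)\<in>Sigma {a. a \<subseteq># s} (\<lambda>a. ?P a \<times> ?P (s - a)). \<phi> u * \<psi> v)"
      by (subst sum.Sigma) (auto simp: finite_submultisets)
    also have "\<dots> = (\<Sum>(w, k)\<in>Sigma (?P s) (\<lambda>w. {..length w}). \<phi> (take k w) * \<psi> (drop k w))"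
    proof (rule sum.reindex_bij_witness[where i = "\<lambda>(w, k). (mset (take k w), take k w, drop k w)"
          and j = "\<lambda>(a, u, v). (u @ v, length u)"], goal_cases)
      case (4 wk)
      have split: "mset w = mset (take k w) + mset (drop k w)" for k and w :: "'a list"
        by (metis append_take_drop_id mset_append)
      have "mset (take k w) \<subseteq># mset w" "mset (drop k w) = mset w - mset (take k w)"
        for k and w :: "'a list"
        unfolding split[of w k] by simp_all
      with 4 show ?case by (auto simp: permutations_of_multiset_def)
    qed (auto simp: permutations_of_multiset_def)
    also have "\<dots> = (\<Sum>w\<in>?P s. \<Sum>k\<le>length w. \<phi> (take k w) * \<psi> (drop k w))"
      by (subst sum.Sigma) auto
    finally show ?thesis using True by (simp add: word_series.rep_eq)
  next
    case False
    have "mps_coeff (word_series V \<phi>) a * mps_coeff (word_series V \<psi>) (s - a) = 0" if "a \<subseteq># s" for a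
    proof -
      have "s = a + (s - a)" using that by simp
      then have "set_mset s = set_mset a \<union> set_mset (s - a)" by (metis set_mset_union)
      then show ?thesis using False by (auto simp: word_series.rep_eq)
    qed
    then show ?thesis using False by (simp add: times_mps.rep_eq word_series.rep_eq)
  qed
qed

lemma euler_word_series: "euler (word_series V \<phi>) = word_series V (\<lambda>w. of_nat (length w) * \<phi> w)"
  by (rule mps_eqI)
    (simp add: euler.rep_eq word_series.rep_eq sum_distrib_left length_permutations_of_multiset)

text \<open>Rotation permutes the arrangements of a multiset. In a word series, a weight may
  therefore be evaluated at a rotated word instead.\<close>

lemma sum_permutations_of_multiset_rotate:
  fixes \<phi> :: "'v list \<Rightarrow> 'a::comm_monoid_add"
  shows "(\<Sum>w\<in>permutations_of_multiset s. \<phi> (rotate j w)) = (\<Sum>w\<in>permutations_of_multiset s. \<phi> w)"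
proof -
  have "inj (rotate1 :: 'v list \<Rightarrow> _)"
    by (rule injI) (metis rotate1_hd_tl rotate1_is_Nil_conv append1_eq_conv list.collapse)
  then have "inj (rotate j :: 'v list \<Rightarrow> _)"
    unfolding rotate_def by (rule inj_fn)
  then have "inj_on (rotate j) (permutations_of_multiset s)"
    by (rule inj_on_subset) simp
  moreover have "mset (rotate j w) = mset w" for w :: "'v list"
  proof (induction j)
    case (Suc j)
    have "mset (rotate1 u) = mset u" for u :: "'v list" by (cases u) auto
    with Suc show ?case by simp
  qed simp
  then have "rotate j ` permutations_of_multiset s \<subseteq> permutations_of_multiset s"
    by (auto simp: permutations_of_multiset_def)
  ultimately have "bij_betw (rotate j) (permutations_of_multiset s) (permutations_of_multiset s)"
    by (simp add: bij_betw_def endo_inj_surj)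
  then show ?thesis by (rule sum.reindex_bij_betw)
qed

subsection \<open>Path and cycle weights\<close>

definition path_weight :: "('v \<Rightarrow> 'v \<Rightarrow> 'a::comm_ring_1) \<Rightarrow> 'v list \<Rightarrow> 'a" where
  "path_weight a w = (\<Prod>t<length w - 1. a (w ! t) (w ! Suc t))"

definition cycle_weight :: "('v \<Rightarrow> 'v \<Rightarrow> 'a::comm_ring_1) \<Rightarrow> 'v list \<Rightarrow> 'a" where
  "cycle_weight a w = (\<Prod>t<length w. a (w ! t) (w ! (Suc t mod length w)))"

text \<open>What remains of a closed walk, partly switched from \<open>a\<close> to
  \<open>1 - a\<close>, when it is cut open at an unconstrained step.\<close>

definition mixed_weight :: "('v \<Rightarrow> 'v \<Rightarrow> 'a::comm_ring_1) \<Rightarrow> nat \<Rightarrow> 'v list \<Rightarrow> 'a" where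
  "mixed_weight a m w = (\<Prod>t<length w - 1. if t < m then a (w ! t) (w ! Suc t) else 1 - a (w ! t) (w ! Suc t))"

definition log_weight :: "('v \<Rightarrow> 'v \<Rightarrow> 'a::comm_ring_1) \<Rightarrow> 'v list \<Rightarrow> 'a" where
  "log_weight a w = (if w = [] then 0 else
     cycle_weight a w + (- 1) ^ (length w - 1) * cycle_weight (\<lambda>x y. 1 - a x y) w)"

lemma alternating_telescope:
  "(\<Sum>i<L. (- 1) ^ i * (d i + d (Suc i))) = d 0 - (- 1) ^ L * (d L :: 'a::comm_ring_1)"
  by (induction L) (simp_all add: algebra_simps)

lemma prod_split_at: "(j :: nat) < k \<Longrightarrow> (\<Prod>t<k. f t) = (\<Prod>t<j. f t) * f j * (\<Prod>t\<in>{j<..<k}. f t :: 'a::comm_ring_1)"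
proof -
  assume "j < k"
  then have "{..<k} = insert j ({..<j} \<union> {j<..<k})" by auto
  then show ?thesis by (simp add: prod.union_disjoint algebra_simps disjoint_iff)
qed

text \<open>In \<open>B j\<close> the first \<open>j\<close> steps of the closed walk carry the
  weight \<open>1 - a\<close>. \<open>B j\<close> and \<open>B (Suc j)\<close> differ in step
  \<open>j\<close> only, whose two weights add up to 1. Their sum leaves this step unconstrained and
  is a path weight of the word read from the following letter, that is, rotated by
  \<open>Suc j\<close>. The alternating sum telescopes to \<open>B 0\<close> and \<open>B k\<close>,
  the two parts of \<open>log_weight\<close>.\<close>

lemma log_weight_rotations:
  "log_weight a w = (\<Sum>j<length w. (- 1) ^ j * mixed_weight a (length w - 1 - j) (rotate (Suc j) w))"
proof (cases "w = []")
  case False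
  define k where "k = length w"
  have k: "k > 0" using False by (simp add: k_def)
  define e where "e t = a (w ! t) (w ! (Suc t mod k))" for t
  define B where "B j = (\<Prod>t<k. if t < j then 1 - e t else e t)" for j
  have step: "B j + B (Suc j) = mixed_weight a (k - 1 - j) (rotate (Suc j) w)" if j: "j < k" for j
  proof -
    have "B j = (\<Prod>t<j. 1 - e t) * e j * (\<Prod>t\<in>{j<..<k}. e t)"
      unfolding B_def prod_split_at[OF j] by simp
    moreover have "B (Suc j) = (\<Prod>t<j. 1 - e t) * (1 - e j) * (\<Prod>t\<in>{j<..<k}. e t)"
      unfolding B_def prod_split_at[OF j] by simp
    ultimately have B: "B j + B (Suc j) = (\<Prod>t<j. 1 - e t) * (\<Prod>t\<in>{j<..<k}. e t)"
      by (simp add: algebra_simps)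
    have nth: "rotate (Suc j) w ! t = w ! ((Suc j + t) mod k)" if "t < k" for t
      using that unfolding k_def by (rule nth_rotate)
    have edge: "a (rotate (Suc j) w ! t) (rotate (Suc j) w ! Suc t) = e ((Suc j + t) mod k)"
      if "t < k - 1" for t
    proof -
      have "t < k" "Suc t < k" using that by auto
      then show ?thesis unfolding nth[OF \<open>t < k\<close>] nth[OF \<open>Suc t < k\<close>] e_def by (simp add: mod_Suc_eq)
    qed
    have "mixed_weight a (k - 1 - j) (rotate (Suc j) w)
        = (\<Prod>t<k - 1. if t < k - 1 - j then e ((Suc j + t) mod k) else 1 - e ((Suc j + t) mod k))"
      unfolding mixed_weight_def length_rotate k_def[symmetric]
      by (intro prod.cong refl) (simp add: edge del: rotate_Suc)
    also have "{..<k - 1} = {..<k - 1 - j} \<union> {k - 1 - j..<k - 1}" by auto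
    also have "(\<Prod>t\<in>{..<k - 1 - j} \<union> {k - 1 - j..<k - 1}.
          if t < k - 1 - j then e ((Suc j + t) mod k) else 1 - e ((Suc j + t) mod k))
        = (\<Prod>t<k - 1 - j. e ((Suc j + t) mod k)) * (\<Prod>t\<in>{k - 1 - j..<k - 1}. 1 - e ((Suc j + t) mod k))"
      by (subst prod.union_disjoint) auto
    also have "(\<Prod>t<k - 1 - j. e ((Suc j + t) mod k)) = (\<Prod>t\<in>{j<..<k}. e t)"
      by (rule prod.reindex_bij_witness[where i = "\<lambda>t. t - Suc j" and j = "\<lambda>t. Suc j + t"]) auto
    \<comment> \<open>These steps have passed the end of the original word, so their positions are
      reduced by \<open>k\<close>.\<close>
    also have "(\<Prod>t\<in>{k - 1 - j..<k - 1}. 1 - e ((Suc j + t) mod k)) = (\<Prod>t<j. 1 - e t)"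
    proof (rule prod.reindex_bij_witness[where i = "\<lambda>t. t + k - Suc j" and j = "\<lambda>t. Suc j + t - k"], goal_cases)
      case (5 t)
      then have "Suc j + t = (Suc j + t - k) + k" "Suc j + t - k < k" using j by auto
      then have "(Suc j + t) mod k = Suc j + t - k" by (metis mod_add_self2 mod_less)
      then show ?case by simp
    qed (use j in auto)
    finally show ?thesis unfolding B by (simp add: mult.commute)
  qed
  have "log_weight a w = B 0 - (- 1) ^ k * B k"
    using False k by (cases k) (auto simp: log_weight_def cycle_weight_def B_def e_def k_def)
  also have "\<dots> = (\<Sum>j<k. (- 1) ^ j * (B j + B (Suc j)))"
    by (rule alternating_telescope[symmetric])
  finally show ?thesis by (simp add: step k_def del: rotate_Suc)
qed (simp add: log_weight_def)

text \<open>Summation over all arrangements of a monomial absorbs the rotations of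
  \<open>log_weight_rotations\<close>; the sum is then reindexed by
  \<open>m = length w - 1 - j\<close>.\<close>

lemma word_series_log_weight:
  "word_series V (log_weight a)
    = word_series V (\<lambda>w. \<Sum>m<length w. (- 1) ^ (length w - 1 - m) * mixed_weight a m w)"
proof (rule mps_eqI)
  fix s :: "'a multiset"
  let ?P = "permutations_of_multiset s"
  have "(\<Sum>w\<in>?P. log_weight a w)
      = (\<Sum>w\<in>?P. \<Sum>j<size s. (- 1) ^ j * mixed_weight a (size s - 1 - j) (rotate (Suc j) w))"
    unfolding log_weight_rotations by (intro sum.cong) (simp_all add: length_permutations_of_multiset del: rotate_Suc)
  also have "\<dots> = (\<Sum>j<size s. \<Sum>w\<in>?P. (- 1) ^ j * mixed_weight a (size s - 1 - j) w)"
    by (subst sum.swap, rule sum.cong[OF refl])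
       (rule sum_permutations_of_multiset_rotate[of "\<lambda>w. (- 1) ^ j * mixed_weight a (size s - 1 - j) w" for j])
  also have "\<dots> = (\<Sum>w\<in>?P. \<Sum>j<size s. (- 1) ^ j * mixed_weight a (size s - 1 - j) w)"
    by (rule sum.swap)
  also have "\<dots> = (\<Sum>w\<in>?P. \<Sum>m<size s. (- 1) ^ (size s - 1 - m) * mixed_weight a m w)"
    by (intro sum.cong refl sum.reindex_bij_witness[where i = "\<lambda>m. size s - 1 - m" and j = "\<lambda>m. size s - 1 - m"]) auto
  also have "\<dots> = (\<Sum>w\<in>?P. \<Sum>m<length w. (- 1) ^ (length w - 1 - m) * mixed_weight a m w)"
    by (intro sum.cong refl) (simp_all add: length_permutations_of_multiset)
  finally show "mps_coeff (word_series V (log_weight a)) s = mps_coeff (word_series V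
      (\<lambda>w. \<Sum>m<length w. (- 1) ^ (length w - 1 - m) * mixed_weight a m w)) s"
    by (simp add: word_series.rep_eq)
qed

text \<open>Let \<open>c m k\<close> be the path weight of \<open>w\<close> with the steps from
  \<open>m\<close> up to \<open>k - 1\<close> switched to \<open>1 - a\<close>. Cutting at
  \<open>k\<close> frees the step between the two factors, so \<open>T m k\<close> is
  \<open>c m (k - 1) + c m k\<close>. For fixed \<open>m\<close> the alternating sum over
  \<open>k\<close> telescopes to \<open>c m m\<close>, the plain path weight, and \<open>m\<close>
  takes \<open>length w\<close> values.\<close>

lemma sum_mixed_weight_path_weight:
  "(\<Sum>k\<le>length w. (\<Sum>m<k. (- 1) ^ (k - 1 - m) * mixed_weight a m (take k w)) * path_weight a (drop k w))
    = of_nat (length w) * path_weight a w"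
proof -
  define n where "n = length w"
  define e where "e t = a (w ! t) (w ! Suc t)" for t
  define c where "c m k = (\<Prod>t<n - 1. if m \<le> t \<and> t < k then 1 - e t else e t)" for m k
  define T where "T m k = mixed_weight a m (take k w) * path_weight a (drop k w)" for m k
  have path: "path_weight a (drop k w) = (\<Prod>t\<in>{k..<n - 1}. e t)" for k
  proof -
    have "path_weight a (drop k w) = (\<Prod>t<n - k - 1. e (k + t))"
      unfolding path_weight_def length_drop n_def[symmetric]
      by (intro prod.cong refl) (simp add: e_def n_def)
    also have "\<dots> = (\<Prod>t\<in>{k..<n - 1}. e t)"
      by (rule prod.reindex_bij_witness[where i = "\<lambda>t. t - k" and j = "\<lambda>t. k + t"]) auto
    finally show ?thesis .
  qed
  have mixed: "mixed_weight a m (take k w) = (\<Prod>t<k - 1. if t < m then e t else 1 - e t)" if "k \<le> n" for m k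
    unfolding mixed_weight_def using that by (intro prod.cong) (auto simp: e_def n_def)
  have T: "T m k = c m (k - 1) + c m k" if "m < k" "k < n" for m k
  proof -
    have k: "k - 1 < n - 1" using that by auto
    have gt: "{k - 1<..<n - 1} = {k..<n - 1}" using that by auto
    have "(\<Prod>t<k - 1. if m \<le> t \<and> t < k' then 1 - e t else e t) = (\<Prod>t<k - 1. if t < m then e t else 1 - e t)"
      if "k - 1 \<le> k'" for k' using that by (intro prod.cong) auto
    moreover have "(\<Prod>t\<in>{k..<n - 1}. if m \<le> t \<and> t < k' then 1 - e t else e t) = (\<Prod>t\<in>{k..<n - 1}. e t)"
      if "k' \<le> k" for k' using that by (intro prod.cong) auto
    ultimately have "c m k' = (\<Prod>t<k - 1. if t < m then e t else 1 - e t)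
        * (if k - 1 < k' then 1 - e (k - 1) else e (k - 1)) * (\<Prod>t\<in>{k..<n - 1}. e t)"
      if "k - 1 \<le> k'" "k' \<le> k" for k'
      unfolding c_def prod_split_at[OF k] gt using that \<open>m < k\<close> by simp
    from this[of k] this[of "k - 1"] show ?thesis
      using that by (simp add: T_def path mixed algebra_simps)
  qed
  \<comment> \<open>When the prefix is the whole word, no step follows it. The single term left over
    cancels the far end of the telescoping sum.\<close>
  have Tn: "T m n = c m (n - 1)" for m
    unfolding T_def path c_def by (simp add: mixed) (intro prod.cong refl, auto)
  have c0: "c m m = path_weight a w" for m
  proof -
    have "c m m = (\<Prod>t<n - 1. e t)" unfolding c_def by (intro prod.cong) auto
    then show ?thesis using path[of 0] by (simp add: atLeast0LessThan)
  qed
  have fixed_m: "(\<Sum>i<n - m. (- 1) ^ i * T m (Suc (m + i))) = path_weight a w" if m: "m < n" for m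
  proof -
    define L where "L = n - 1 - m"
    have L: "n - m = Suc L" "Suc (m + L) = n" using m by (auto simp: L_def)
    have "(\<Sum>i<L. (- 1) ^ i * T m (Suc (m + i))) = (\<Sum>i<L. (- 1) ^ i * (c m (m + i) + c m (m + Suc i)))"
      by (intro sum.cong refl) (use L in \<open>simp add: T\<close>)
    also have "\<dots> = c m m - (- 1) ^ L * c m (m + L)"
      using alternating_telescope[of "\<lambda>i. c m (m + i)" L] by simp
    also have "m + L = n - 1" using L by simp
    finally show ?thesis by (simp add: L Tn c0)
  qed
  have "(\<Sum>k\<le>n. (\<Sum>m<k. (- 1) ^ (k - 1 - m) * mixed_weight a m (take k w)) * path_weight a (drop k w))
      = (\<Sum>(k, m)\<in>Sigma {..n} (\<lambda>k. {..<k}). (- 1) ^ (k - 1 - m) * T m k)"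
    unfolding T_def sum_distrib_right mult.assoc by (subst sum.Sigma) auto
  also have "\<dots> = (\<Sum>(m, i)\<in>Sigma {..<n} (\<lambda>m. {..<n - m}). (- 1) ^ i * T m (Suc (m + i)))"
    by (rule sum.reindex_bij_witness[where i = "\<lambda>(m, i). (Suc (m + i), m)" and j = "\<lambda>(k, m). (m, k - 1 - m)"]) auto
  also have "\<dots> = (\<Sum>m<n. path_weight a w)"
    by (subst sum.Sigma[symmetric]) (auto simp: fixed_m)
  finally show ?thesis by (simp add: n_def)
qed

text \<open>Once \<open>log_weight\<close> is replaced by its mixed form, both sides are word series
  whose weights agree word by word.\<close>

lemma euler_path_series:
  "euler (word_series V (path_weight a)) = word_series V (log_weight a) * word_series V (path_weight a)"
  unfolding word_series_log_weight word_series_mult euler_word_series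
proof (rule word_series_cong)
  fix w :: "'a list"
  have "(\<Sum>k\<le>length w. (\<Sum>m<length (take k w). (- 1) ^ (length (take k w) - 1 - m) * mixed_weight a m (take k w))
      * path_weight a (drop k w))
    = (\<Sum>k\<le>length w. (\<Sum>m<k. (- 1) ^ (k - 1 - m) * mixed_weight a m (take k w)) * path_weight a (drop k w))"
    by (intro sum.cong refl) (simp add: min_def)
  then show "of_nat (length w) * path_weight a w
    = (\<Sum>k\<le>length w. (\<Sum>m<length (take k w). (- 1) ^ (length (take k w) - 1 - m) * mixed_weight a m (take k w))
      * path_weight a (drop k w))"
    by (simp only: sum_mixed_weight_path_weight)
qed

section \<open>Coefficients of symmetric functions\<close>

lemma mps_coeff_var_mult:
  fixes f :: "('v, 'a::comm_ring_1) mps"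
  shows "mps_coeff (mps_var v * f) m = (if v \<in># m then mps_coeff f (m - {#v#}) else 0)"
proof -
  have "mps_coeff (mps_var v * f) m
      = (\<Sum>a\<in>{a. a \<subseteq># m}. if a = {#v#} then mps_coeff f (m - {#v#}) else 0)"
    unfolding times_mps.rep_eq mps_var.rep_eq by (rule sum.cong) auto
  then show ?thesis by (simp add: finite_submultisets)
qed

lemma mps_coeff_prod_var:
  assumes "finite A"
  shows "mps_coeff (\<Prod>r\<in>A. mps_var (i r) :: ('v, 'a::comm_ring_1) mps) m
    = (if image_mset i (mset_set A) = m then 1 else 0)"
  using assms
proof (induction arbitrary: m)
  case (insert x A)
  then show ?case
    by (auto simp: mps_coeff_var_mult dest!: multi_member_split)
qed (auto simp: one_mps.rep_eq)

lemma mps_coeff_power_var: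
  "mps_coeff (mps_var v ^ k :: ('v, 'a::comm_ring_1) mps) m = (if m = replicate_mset k v then 1 else 0)"
proof -
  have "mps_var v ^ k = (\<Prod>r<k. mps_var v :: ('v, 'a) mps)" by simp
  then show ?thesis
    by (simp only: mps_coeff_prod_var finite_lessThan) (auto simp: image_mset_const_eq)
qed

text \<open>For \<open>k = 0\<close> the family consists of infinitely many ones and
  \<open>p_sym 0\<close> defaults to 0, hence the restriction to positive \<open>k\<close>.\<close>

lemma mps_coeff_p_sym:
  assumes "k > 0"
  shows "mps_coeff (p_sym k) m = (if \<exists>v\<ge>1. m = replicate_mset k v then 1 else 0)"
proof (cases "\<exists>v\<ge>1. m = replicate_mset k v")
  case True
  then obtain v where v: "v \<ge> 1" "m = replicate_mset k v" by blast
  have "mps_coeff (p_sym k) m = (\<Sum>v\<in>{v}. mps_coeff (Z v ^ k) m)"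
    unfolding p_sym_def using v assms
    by (intro mps_coeff_sum_family) (auto simp: mps_coeff_power_var replicate_mset_eq_iff)
  with v show ?thesis by (auto simp: mps_coeff_power_var)
next
  case False
  have "mps_coeff (p_sym k) m = (\<Sum>v\<in>{}. mps_coeff (Z v ^ k) m)"
    unfolding p_sym_def using False
    by (intro mps_coeff_sum_family) (auto simp: mps_coeff_power_var)
  with False show ?thesis by simp
qed

lemma mps_coeff_p_sym_mult:
  assumes "k > 0"
  shows "mps_coeff (p_sym k * f) m
    = (\<Sum>v | v \<in># m \<and> v \<ge> 1 \<and> k \<le> count m v. mps_coeff f (m - replicate_mset k v))"
proof -
  let ?A = "{v. v \<in># m \<and> v \<ge> 1 \<and> k \<le> count m v}"
  have inj: "inj_on (replicate_mset k) ?A"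
    using assms by (auto simp: inj_on_def replicate_mset_eq_iff)
  have "mps_coeff (p_sym k * f) m
      = (\<Sum>a\<in>replicate_mset k ` ?A. mps_coeff (p_sym k) a * mps_coeff f (m - a))"
    unfolding times_mps.rep_eq
  proof (rule sum.mono_neutral_right)
    show "\<forall>a\<in>{a. a \<subseteq># m} - replicate_mset k ` ?A. mps_coeff (p_sym k) a * mps_coeff f (m - a) = 0"
    proof
      fix a assume a: "a \<in> {a. a \<subseteq># m} - replicate_mset k ` ?A"
      have "v \<in> ?A" if "v \<ge> 1" "a = replicate_mset k v" for v
        using a that assms by (auto simp: count_le_replicate_mset_subset_eq[symmetric] simp flip: count_greater_zero_iff)
      then have "\<not> (\<exists>v\<ge>1. a = replicate_mset k v)" using a by blast
      then show "mps_coeff (p_sym k) a * mps_coeff f (m - a) = 0"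
        by (subst mps_coeff_p_sym[OF assms]) (simp only: if_False mult_zero_left)
    qed
  qed (auto simp: finite_submultisets count_le_replicate_mset_subset_eq[symmetric])
  also have "\<dots> = (\<Sum>v\<in>?A. mps_coeff (p_sym k) (replicate_mset k v) * mps_coeff f (m - replicate_mset k v))"
    unfolding sum.reindex[OF inj] by simp
  also have "\<dots> = (\<Sum>v\<in>?A. mps_coeff f (m - replicate_mset k v))"
    by (intro sum.cong refl) (auto simp: mps_coeff_p_sym[OF assms])
  finally show ?thesis .
qed

text \<open>The only weakly increasing index sequence that produces the monomial \<open>m\<close>.
  Positions start at 1, list indices at 0, and \<open>restrict\<close> places it in the extensional
  function space of the definitions.\<close>

definition sorted_index :: "nat multiset \<Rightarrow> nat \<Rightarrow> nat" where
  "sorted_index m = restrict (\<lambda>r. sorted_list_of_multiset m ! (r - 1)) {1..size m}"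

lemma mset_map_index: "image_mset i (mset_set {1..n}) = mset (map i [1..<Suc n])"
  by (simp add: mset_map del: upt_Suc) (metis atLeastLessThanSuc_atLeastAtMost mset_upt)

lemma mono_index_eq:
  assumes i: "i \<in> {1..n} \<rightarrow>\<^sub>E {1..}" "mono_on {1..n} i" and m: "image_mset i (mset_set {1..n}) = m"
  shows "size m = n" "0 \<notin># m" "i = sorted_index m"
proof -
  show sz: "size m = n" using m by auto
  show "0 \<notin># m" using i(1) m by (fastforce simp: PiE_def Pi_def)
  have "sorted (map i [1..<Suc n])"
    unfolding sorted_map by (rule sorted_wrt_mono_rel[OF _ sorted_wrt_upt])
      (use i(2) in \<open>auto simp: mono_on_def\<close>)
  then have eq: "sorted_list_of_multiset m = map i [1..<Suc n]"
    by (simp only: m[symmetric] mset_map_index sorted_list_of_multiset_mset sorted_sort_id)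
  show "i = sorted_index m"
  proof
    fix r
    show "i r = sorted_index m r"
      using i(1) by (auto simp: sorted_index_def sz eq nth_map PiE_def extensional_def simp del: upt_Suc)
  qed
qed

lemma sorted_index_mono:
  assumes "0 \<notin># m"
  shows "sorted_index m \<in> {1..size m} \<rightarrow>\<^sub>E {1..}" "mono_on {1..size m} (sorted_index m)"
    "image_mset (sorted_index m) (mset_set {1..size m}) = m"
proof -
  let ?c = "sorted_list_of_multiset m"
  have len: "length ?c = size m" by (metis mset_sorted_list_of_multiset size_mset)
  have "?c ! (r - 1) \<in># m" if "r \<in> {1..size m}" for r
  proof -
    have "?c ! (r - 1) \<in> set ?c" using that len by (intro nth_mem) auto
    then show ?thesis by simp
  qed
  then show "sorted_index m \<in> {1..size m} \<rightarrow>\<^sub>E {1..}"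
    using assms by (auto simp: sorted_index_def) (metis not_less_eq_eq le0 le_0_eq One_nat_def)
  show "mono_on {1..size m} (sorted_index m)"
    unfolding mono_on_def sorted_index_def
    by (auto intro!: sorted_nth_mono simp: len)
  have "map (sorted_index m) [1..<Suc (size m)] = ?c"
    by (rule nth_equalityI) (auto simp: len sorted_index_def simp del: upt_Suc)
  then show "image_mset (sorted_index m) (mset_set {1..size m}) = m"
    by (simp only: mset_map_index mset_sorted_list_of_multiset)
qed

text \<open>Since a monomial determines its weakly increasing index sequence, at most one member of
  the family contributes. The extra condition \<open>R\<close> allows one argument for
  \<open>h_sym\<close>, \<open>e_sym\<close> and \<open>F_qsym\<close>.\<close>

lemma mps_coeff_index_sum:
  "mps_coeff (mps_sum (\<lambda>i. \<Prod>r=1..n. Z (i r)) {i \<in> {1..n} \<rightarrow>\<^sub>E {1..}. mono_on {1..n} i \<and> R i}) m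
    = (if size m = n \<and> 0 \<notin># m \<and> R (sorted_index m) then 1 else 0)"
proof -
  let ?S = "{i \<in> {1..n} \<rightarrow>\<^sub>E {1..}. mono_on {1..n} i \<and> R i}"
  let ?A = "if size m = n \<and> 0 \<notin># m \<and> R (sorted_index m) then {sorted_index m} else {}"
  have zero: "mps_coeff (\<Prod>r=1..n. Z (i r)) m = 0" if i: "i \<in> ?S" "i \<notin> ?A" for i
  proof -
    have "image_mset i (mset_set {1..n}) \<noteq> m"
    proof
      assume m: "image_mset i (mset_set {1..n}) = m"
      from i(1) have "i \<in> {1..n} \<rightarrow>\<^sub>E {1..}" "mono_on {1..n} i" "R i" by auto
      with mono_index_eq[OF this(1,2) m] i(2) show False by auto
    qed
    then show ?thesis by (simp add: mps_coeff_prod_var)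
  qed
  have "mps_coeff (mps_sum (\<lambda>i. \<Prod>r=1..n. Z (i r)) ?S) m = (\<Sum>i\<in>?A. mps_coeff (\<Prod>r=1..n. Z (i r)) m)"
  proof (rule mps_coeff_sum_family)
    show "?A \<subseteq> ?S" using sorted_index_mono(1,2)[of m] by auto
  qed (use zero in auto)
  then show ?thesis using sorted_index_mono(3)[of m] by (auto simp: mps_coeff_prod_var)
qed

lemma mps_coeff_h_sym: "mps_coeff (h_sym j) m = (if size m = j \<and> 0 \<notin># m then 1 else 0)"
  using mps_coeff_index_sum[of j "\<lambda>_. True" m] by (simp add: h_sym_def)

lemma strict_mono_sorted_index:
  assumes "0 \<notin># m"
  shows "strict_mono_on {1..size m} (sorted_index m) \<longleftrightarrow> (\<forall>v. count m v \<le> 1)"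
proof -
  let ?c = "sorted_list_of_multiset m"
  have len: "length ?c = size m" by (metis mset_sorted_list_of_multiset size_mset)
  have "(\<forall>v. count m v \<le> 1) \<longleftrightarrow> distinct ?c"
  proof -
    have "distinct ?c \<longleftrightarrow> (\<forall>v. count m v = (if v \<in># m then 1 else 0))"
      by (simp add: distinct_count_atmost_1)
    also have "\<dots> \<longleftrightarrow> (\<forall>v. count m v \<le> 1)"
      by (metis count_eq_zero_iff count_greater_eq_one_iff le_antisym order_refl zero_le)
    finally show ?thesis by simp
  qed
  also have "\<dots> \<longleftrightarrow> inj_on (sorted_index m) {1..size m}"
  proof
    assume d: "distinct ?c"
    show "inj_on (sorted_index m) {1..size m}"
    proof (rule inj_onI)
      fix r s assume "r \<in> {1..size m}" "s \<in> {1..size m}" "sorted_index m r = sorted_index m s"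
      then show "r = s"
        using nth_eq_iff_index_eq[OF d, of "r - 1" "s - 1"] by (fastforce simp: sorted_index_def len)
    qed
  next
    assume inj: "inj_on (sorted_index m) {1..size m}"
    show "distinct ?c"
      unfolding distinct_conv_nth
    proof (intro allI impI)
      fix r s assume "r < length ?c" "s < length ?c" "r \<noteq> s"
      then show "?c ! r \<noteq> ?c ! s"
        using inj_onD[OF inj, of "Suc r" "Suc s"] by (auto simp: sorted_index_def len)
    qed
  qed
  also have "\<dots> \<longleftrightarrow> strict_mono_on {1..size m} (sorted_index m)"
  proof
    assume "inj_on (sorted_index m) {1..size m}"
    then show "strict_mono_on {1..size m} (sorted_index m)"
      using sorted_index_mono(2)[OF assms] unfolding strict_mono_on_def mono_on_def inj_on_def
      by (metis order_less_imp_le order_less_le nat_neq_iff)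
  qed (rule strict_mono_on_imp_inj_on)
  finally show ?thesis by simp
qed

lemma mps_coeff_e_sym:
  "mps_coeff (e_sym j) m = (if size m = j \<and> 0 \<notin># m \<and> (\<forall>v. count m v \<le> 1) then 1 else 0)"
proof -
  have mono: "mono_on A i" if "strict_mono_on A i" for A and i :: "nat \<Rightarrow> nat"
    using that unfolding mono_on_def strict_mono_on_def by (metis order_le_less)
  have "{i \<in> {1..j} \<rightarrow>\<^sub>E {1::nat..}. strict_mono_on {1..j} i}
      = {i \<in> {1..j} \<rightarrow>\<^sub>E {1..}. mono_on {1..j} i \<and> strict_mono_on {1..j} i}"
    by (rule Collect_cong) (metis mono)
  then show ?thesis
    using mps_coeff_index_sum[of j "strict_mono_on {1..j}" m] strict_mono_sorted_index[of m]
    by (auto simp: e_sym_def)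
qed

subsection \<open>Newton's identities\<close>

text \<open>Multiplication by \<open>p_sym k\<close> removes \<open>k\<close> copies of one variable
  from a monomial, so the convolution runs over pairs of a variable and a positive number of its
  copies. Both Newton identities are read off from this.\<close>

lemma newton_coeff:
  fixes c :: "nat \<Rightarrow> zseries" and \<epsilon> :: "nat \<Rightarrow> rat"
  assumes "\<epsilon> 0 = 0" and hom: "\<And>j m. mps_coeff (c j) m \<noteq> 0 \<Longrightarrow> size m = j \<and> 0 \<notin># m"
  shows "mps_coeff (\<Sum>k\<le>j. mps_const (\<epsilon> k) * p_sym k * c (j - k)) m
    = (if size m = j \<and> 0 \<notin># m then
        \<Sum>v\<in>set_mset m. \<Sum>k=1..count m v. \<epsilon> k * mps_coeff (c (j - k)) (m - replicate_mset k v) else 0)"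
proof -
  let ?x = "\<lambda>k v. \<epsilon> k * mps_coeff (c (j - k)) (m - replicate_mset k v)"
  have "mps_coeff (\<Sum>k\<le>j. mps_const (\<epsilon> k) * p_sym k * c (j - k)) m
      = (\<Sum>k=1..j. mps_coeff (mps_const (\<epsilon> k) * p_sym k * c (j - k)) m)"
    unfolding mps_coeff_sum using assms(1)
    by (intro sum.mono_neutral_right) (auto simp: zero_mps.rep_eq not_less_eq_eq)
  also have "\<dots> = (\<Sum>k=1..j. \<Sum>v | v \<in># m \<and> v \<ge> 1 \<and> k \<le> count m v. ?x k v)"
    by (intro sum.cong refl) (simp add: mult.assoc mps_coeff_p_sym_mult sum_distrib_left)
  also have "\<dots> = (if size m = j \<and> 0 \<notin># m then \<Sum>v\<in>set_mset m. \<Sum>k=1..count m v. ?x k v else 0)"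
  proof (cases "size m = j \<and> 0 \<notin># m")
    case True
    have le: "count m v \<le> j" for v using True by (metis count_le_size)
    have "(\<Sum>k=1..j. \<Sum>v | v \<in># m \<and> v \<ge> 1 \<and> k \<le> count m v. ?x k v)
        = (\<Sum>(k, v)\<in>Sigma {1..j} (\<lambda>k. {v. v \<in># m \<and> v \<ge> 1 \<and> k \<le> count m v}). ?x k v)"
      by (subst sum.Sigma) auto
    also have "\<dots> = (\<Sum>(v, k)\<in>Sigma (set_mset m) (\<lambda>v. {1..count m v}). ?x k v)"
      using True le
      by (intro sum.reindex_bij_witness[where i = "\<lambda>(v, k). (k, v)" and j = "\<lambda>(k, v). (v, k)"])
        (auto intro: Suc_leI gr0I simp del: count_eq_zero_iff, meson order_trans)
    also have "\<dots> = (\<Sum>v\<in>set_mset m. \<Sum>k=1..count m v. ?x k v)"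
      by (subst sum.Sigma) auto
    finally show ?thesis using True by simp
  next
    case False
    have "mps_coeff (c (j - k)) (m - replicate_mset k v) = 0"
      if "k \<in> {1..j}" "v \<ge> 1" "k \<le> count m v" for k v
    proof (rule ccontr)
      assume "mps_coeff (c (j - k)) (m - replicate_mset k v) \<noteq> 0"
      then have "size (m - replicate_mset k v) = j - k" "0 \<notin># m - replicate_mset k v"
        using hom by blast+
      moreover have "size (m - replicate_mset k v) = size m - k"
        using that by (simp add: size_Diff_submset count_le_replicate_mset_subset_eq[symmetric])
      moreover have "k \<le> size m" using that by (metis count_le_size order_trans)
      moreover have "count (m - replicate_mset k v) 0 = count m 0" using that by simp
      ultimately show False using False that by (auto simp flip: count_eq_zero_iff)
    qed
    then show ?thesis using False by (auto intro!: sum.neutral)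
  qed
  finally show ?thesis .
qed

text \<open>Every pair of a variable and a number of copies to remove contributes 1, and the
  multiplicities add up to the degree.\<close>

lemma newton_h:
  "of_nat j * h_sym j = (\<Sum>k\<le>j. mps_const (if k = 0 then 0 else 1) * p_sym k * h_sym (j - k))"
proof (rule mps_eqI)
  fix m
  have "(\<Sum>v\<in>set_mset m. \<Sum>k=1..count m v. (if k = 0 then 0 else 1) * mps_coeff (h_sym (j - k)) (m - replicate_mset k v))
      = of_nat j" if "size m = j" "0 \<notin># m"
  proof -
    have "(\<Sum>k=1..count m v. (if k = 0 then 0 else 1) * mps_coeff (h_sym (j - k)) (m - replicate_mset k v))
        = of_nat (count m v)" for v
    proof -
      have "(\<Sum>k=1..count m v. (if k = 0 then 0 else 1) * mps_coeff (h_sym (j - k)) (m - replicate_mset k v))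
        = (\<Sum>k=1..count m v. 1)"
        using that by (intro sum.cong refl)
          (auto simp: mps_coeff_h_sym size_Diff_submset count_le_replicate_mset_subset_eq[symmetric] dest: in_diffD)
      then show ?thesis by simp
    qed
    then show ?thesis using that by (simp add: size_multiset_overloaded_eq flip: of_nat_sum)
  qed
  then show "mps_coeff (of_nat j * h_sym j) m
      = mps_coeff (\<Sum>k\<le>j. mps_const (if k = 0 then 0 else 1) * p_sym k * h_sym (j - k)) m"
    by (subst newton_coeff) (auto simp: mps_coeff_h_sym split: if_splits)
qed

text \<open>Removing copies of \<open>v\<close> leaves a square-free monomial only if the other
  variables are simple and at most one \<open>v\<close> remains. If \<open>v\<close> is multiple,
  removing all copies and all but one have opposite signs and cancel; if it is simple, the only
  choice contributes 1.\<close>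

lemma newton_e:
  "of_nat j * e_sym j = (\<Sum>k\<le>j. mps_const (if k = 0 then 0 else (- 1) ^ (k - 1)) * p_sym k * e_sym (j - k))"
proof (rule mps_eqI)
  fix m
  let ?\<epsilon> = "\<lambda>k. if k = 0 then 0 else (- 1) ^ (k - 1) :: rat"
  have "(\<Sum>v\<in>set_mset m. \<Sum>k=1..count m v. ?\<epsilon> k * mps_coeff (e_sym (j - k)) (m - replicate_mset k v))
      = (if \<forall>v. count m v \<le> 1 then of_nat j else 0)" if m: "size m = j" "0 \<notin># m"
  proof -
    have inner: "(\<Sum>k=1..count m v. ?\<epsilon> k * mps_coeff (e_sym (j - k)) (m - replicate_mset k v))
        = (if \<forall>v. count m v \<le> 1 then 1 else 0)" if v: "v \<in># m" for v
    proof -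
      define P where "P \<longleftrightarrow> (\<forall>u. u \<noteq> v \<longrightarrow> count m u \<le> 1)"
      obtain c where c: "count m v = Suc c" using v by (metis count_greater_zero_iff gr0_implies_Suc)
      have e: "mps_coeff (e_sym (j - k)) (m - replicate_mset k v) = (if P \<and> count m v - k \<le> 1 then 1 else 0)"
        if "k \<in> {1..count m v}" for k
      proof -
        have "size (m - replicate_mset k v) = j - k" "0 \<notin># m - replicate_mset k v"
          using m that by (auto simp: size_Diff_submset count_le_replicate_mset_subset_eq[symmetric] dest: in_diffD)
        moreover have "(\<forall>u. count (m - replicate_mset k v) u \<le> 1) \<longleftrightarrow> P \<and> count m v - k \<le> 1"
          unfolding P_def by (auto split: if_splits)
        ultimately show ?thesis by (simp only: mps_coeff_e_sym) auto
      qed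
      have "(\<Sum>k=1..count m v. ?\<epsilon> k * mps_coeff (e_sym (j - k)) (m - replicate_mset k v))
          = (\<Sum>k=1..count m v. if P \<and> count m v - k \<le> 1 then ?\<epsilon> k else 0)"
        by (intro sum.cong refl) (simp add: e)
      also have "\<dots> = (if P \<and> c = 0 then 1 else 0)"
      proof (cases "c = 0 \<or> \<not> P")
        case False
        then obtain d where d: "c = Suc d" by (cases c) auto
        have "(\<Sum>k=1..count m v. if P \<and> count m v - k \<le> 1 then ?\<epsilon> k else 0) = (\<Sum>k\<in>{c, Suc c}. ?\<epsilon> k)"
          using False by (intro sum.mono_neutral_cong_right) (auto simp: c)
        then show ?thesis using False by (simp add: d)
      qed (auto simp: c)
      also have "P \<and> c = 0 \<longleftrightarrow> (\<forall>v. count m v \<le> 1)"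
      proof
        assume "P \<and> c = 0"
        then have "count m u \<le> 1" for u using c by (cases "u = v") (auto simp: P_def)
        then show "\<forall>v. count m v \<le> 1" by blast
      next
        assume "\<forall>v. count m v \<le> 1"
        then show "P \<and> c = 0" using c[symmetric] by (metis P_def One_nat_def Suc_le_mono le_zero_eq)
      qed
      finally show ?thesis by simp
    qed
    have "(\<Sum>v\<in>set_mset m. if \<forall>v. count m v \<le> 1 then 1 else 0 :: rat) = (if \<forall>v. count m v \<le> 1 then of_nat j else 0)"
    proof (cases "\<forall>v. count m v \<le> 1")
      case True
      then have "count m v = 1" if "v \<in># m" for v
        using that by (metis count_greater_eq_one_iff le_antisym)
      then have "card (set_mset m) = j" using m(1) by (simp add: size_multiset_overloaded_eq)
      with True show ?thesis by simp
    qed auto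
    then show ?thesis using inner by (simp cong: sum.cong)
  qed
  then show "mps_coeff (of_nat j * e_sym j) m = mps_coeff (\<Sum>k\<le>j. mps_const (?\<epsilon> k) * p_sym k * e_sym (j - k)) m"
    by (subst newton_coeff) (auto simp: mps_coeff_e_sym split: if_splits)
qed

section \<open>Products over colours\<close>

lift_definition component :: "nat \<Rightarrow> ('v, 'a::zero) mps \<Rightarrow> ('v, 'a) mps"
  is "\<lambda>r f m. if size m = r then f m else 0" .

lemma component_mult:
  fixes f g :: "('v, 'a::comm_ring_1) mps"
  shows "component r (f * g) = (\<Sum>k\<le>r. component k f * component (r - k) g)"
proof (rule mps_eqI)
  fix m :: "'v multiset"
  have "mps_coeff (\<Sum>k\<le>r. component k f * component (r - k) g) m
      = (\<Sum>a\<in>{a. a \<subseteq># m}. \<Sum>k\<le>r. mps_coeff (component k f) a * mps_coeff (component (r - k) g) (m - a))"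
    unfolding mps_coeff_sum times_mps.rep_eq by (rule sum.swap)
  also have "\<dots> = (\<Sum>a\<in>{a. a \<subseteq># m}. if size m = r then mps_coeff f a * mps_coeff g (m - a) else 0)"
  proof (intro sum.cong refl)
    fix a assume "a \<in> {a. a \<subseteq># m}"
    then have sz: "size (m - a) = size m - size a" "size a \<le> size m"
      by (auto simp: size_Diff_submset size_mset_mono)
    have "(\<Sum>k\<le>r. mps_coeff (component k f) a * mps_coeff (component (r - k) g) (m - a))
        = (\<Sum>k\<le>r. if k = size a then (if size m = r then mps_coeff f a * mps_coeff g (m - a) else 0) else 0)"
      using sz by (intro sum.cong refl) (auto simp: component.rep_eq)
    also have "\<dots> = (if size m = r then mps_coeff f a * mps_coeff g (m - a) else 0)"
      using sz by auto
    finally show "(\<Sum>k\<le>r. mps_coeff (component k f) a * mps_coeff (component (r - k) g) (m - a))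
      = (if size m = r then mps_coeff f a * mps_coeff g (m - a) else 0)" .
  qed
  also have "\<dots> = mps_coeff (component r (f * g)) m"
    by (simp add: component.rep_eq times_mps.rep_eq)
  finally show "mps_coeff (component r (f * g)) m = mps_coeff (\<Sum>k\<le>r. component k f * component (r - k) g) m" ..
qed

lemma euler_component: "euler (component r f) = component r (euler f)"
  by (rule mps_eqI) (simp add: euler.rep_eq component.rep_eq)

lemma component_0: "component 0 f = mps_const (mps_coeff f {#})"
  by (rule mps_eqI) (auto simp: component.rep_eq mps_const.rep_eq)

lemma component_word_series:
  "component r (word_series V \<phi>) = word_series V (\<lambda>w. if length w = r then \<phi> w else 0)"
  by (rule mps_eqI) (auto simp: component.rep_eq word_series.rep_eq length_permutations_of_multiset intro!: sum.neutral)

text \<open>The coefficient of the \<open>z\<close>-monomial \<open>m\<close> in the product over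
  \<open>v\<close> of the copies of \<open>H\<close> scaled by \<open>z_v\<close>: scaling attaches
  \<open>z_v ^ r\<close> to the component of degree \<open>r\<close>. Colours outside
  \<open>m\<close> would contribute the component of degree 0, which is 1 when \<open>H\<close> has
  constant term 1.\<close>

definition colour_term :: "('v, rat) mps \<Rightarrow> nat multiset \<Rightarrow> ('v, rat) mps" where
  "colour_term H m = (\<Prod>v\<in>set_mset m. component (count m v) H)"

text \<open>The product of the series obtained from \<open>H\<close> by scaling all variables by \<open>z\<^sub>1\<close>, by \<open>z\<^sub>2\<close>, and so on.\<close>

lift_definition colour_coeff :: "('v, rat) mps \<Rightarrow> 'v multiset \<Rightarrow> zseries"
  is "\<lambda>H s m. if 0 \<in># m then 0 else mps_coeff (colour_term H m) s" .

lift_definition colour_product :: "('v, rat) mps \<Rightarrow> ('v, zseries) mps" is colour_coeff .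

text \<open>Removal of \<open>k\<close> copies of \<open>v\<close> affects only the factor of
  \<open>v\<close>. If no copy is left, \<open>v\<close> drops out of the product, which is harmless
  because its factor would be the constant term 1.\<close>

lemma colour_term_remove:
  assumes H: "mps_coeff H {#} = 1" and v: "v \<in># m" and k: "1 \<le> k" "k \<le> count m v"
  shows "component (count m v - k) H * (\<Prod>u\<in>set_mset m - {v}. component (count m u) H)
    = colour_term H (m - replicate_mset k v)"
proof -
  let ?m = "m - replicate_mset k v"
  have "colour_term H ?m = (\<Prod>u\<in>set_mset m. component (count ?m u) H)"
    unfolding colour_term_def
  proof (rule prod.mono_neutral_left)
    show "\<forall>u\<in>set_mset m - set_mset ?m. component (count ?m u) H = 1"
      by (auto simp: H component_0 not_in_iff simp del: count_diff)
  qed (auto dest: in_diffD)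
  also have "\<dots> = component (count ?m v) H * (\<Prod>u\<in>set_mset m - {v}. component (count ?m u) H)"
    using v by (intro prod.remove) auto
  also have "(\<Prod>u\<in>set_mset m - {v}. component (count ?m u) H) = (\<Prod>u\<in>set_mset m - {v}. component (count m u) H)"
    by (intro prod.cong) auto
  finally show ?thesis by simp
qed

text \<open>The product rule differentiates one colour \<open>v\<close> at a time. In each degree
  the equation for \<open>H\<close> splits off a component of \<open>K\<close>, whose degree
  \<open>k\<close> is the number of copies of \<open>v\<close> that it uses up.\<close>

lemma euler_colour_term:
  assumes H: "mps_coeff H {#} = 1" and ode: "euler H = K * H"
  shows "euler (colour_term H m)
    = (\<Sum>v\<in>set_mset m. \<Sum>k=1..count m v. component k K * colour_term H (m - replicate_mset k v))"
proof -
  have K: "mps_coeff K {#} = 0"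
    using arg_cong[OF ode, of "\<lambda>f. mps_coeff f {#}"] by (simp add: H euler.rep_eq)
  have comp: "euler (component r H) = (\<Sum>k=1..r. component k K * component (r - k) H)" for r
    unfolding euler_component ode component_mult
    by (rule sum.mono_neutral_right) (auto simp: component_0 K not_less_eq_eq)
  have "euler (colour_term H m) = (\<Sum>v\<in>set_mset m. \<Sum>k=1..count m v. component k K *
      (component (count m v - k) H * (\<Prod>u\<in>set_mset m - {v}. component (count m u) H)))"
    unfolding colour_term_def by (simp add: euler_prod comp sum_distrib_right mult.assoc)
  also have "\<dots> = (\<Sum>v\<in>set_mset m. \<Sum>k=1..count m v. component k K * colour_term H (m - replicate_mset k v))"
    by (intro sum.cong refl) (simp add: colour_term_remove[OF H])
  finally show ?thesis .
qed

text \<open>The sum over \<open>i\<close> of the copies of \<open>K\<close> scaled by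
  \<open>z_i\<close>: a monomial of degree \<open>k > 0\<close> collects all the
  \<open>z_i ^ k\<close>, which is the power sum.\<close>

lift_definition power_sum_series :: "('v, rat) mps \<Rightarrow> ('v, zseries) mps"
  is "\<lambda>K s. mps_const (K s) * p_sym (size s)" .

text \<open>Logarithmic derivatives add over the colours. The product being infinite, this is
  checked at each \<open>z\<close>-monomial with \<open>euler_colour_term\<close>, where
  multiplication by a power sum is again the removal of equal colours.\<close>

lemma euler_colour_product:
  assumes H: "mps_coeff H {#} = 1" and ode: "euler H = K * H"
  shows "euler (colour_product H) = power_sum_series K * colour_product H"
proof (rule mps_eqI, rule mps_eqI)
  fix s :: "'a multiset" and m :: "nat multiset"
  have K: "mps_coeff K {#} = 0"
    using arg_cong[OF ode, of "\<lambda>f. mps_coeff f {#}"] by (simp add: H euler.rep_eq)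
  let ?T = "\<lambda>a v. mps_coeff (colour_term H (m - replicate_mset (size a) v)) (s - a)"
  \<comment> \<open>The formula for multiplication by a power sum needs positive degree; at the
    empty monomial the factor from \<open>K\<close> vanishes.\<close>
  have mult: "mps_coeff (mps_const (mps_coeff K a) * p_sym (size a) * colour_coeff H (s - a)) m
      = mps_coeff K a * (\<Sum>v | v \<in># m \<and> v \<ge> 1 \<and> size a \<le> count m v.
          mps_coeff (colour_coeff H (s - a)) (m - replicate_mset (size a) v))" for a
  proof (cases "a = {#}")
    case False
    then have "size a > 0" by (simp add: nonempty_has_size)
    then show ?thesis by (simp add: mult.assoc mps_coeff_p_sym_mult)
  qed (simp add: K zero_mps.rep_eq)
  have "mps_coeff (mps_coeff (power_sum_series K * colour_product H) s) m
      = (\<Sum>a\<in>{a. a \<subseteq># s}. mps_coeff K a * (\<Sum>v | v \<in># m \<and> v \<ge> 1 \<and> size a \<le> count m v.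
          mps_coeff (colour_coeff H (s - a)) (m - replicate_mset (size a) v)))"
    by (simp only: times_mps.rep_eq[of "power_sum_series K"] mps_coeff_sum power_sum_series.rep_eq
        colour_product.rep_eq mult)
  also have "\<dots> = mps_coeff (mps_coeff (euler (colour_product H)) s) m"
  proof (cases "0 \<in># m")
    case True
    have "mps_coeff (colour_coeff H (s - a)) (m - replicate_mset (size a) v) = 0" if "v \<ge> 1" for a v
    proof -
      have "count (m - replicate_mset (size a) v) 0 = count m 0" using that by simp
      then have "0 \<in># m - replicate_mset (size a) v" using True by (metis count_eq_zero_iff)
      then show ?thesis by (simp add: colour_coeff.rep_eq)
    qed
    then show ?thesis using True by (simp add: euler.rep_eq colour_product.rep_eq colour_coeff.rep_eq)
  next
    case False
    have "(\<Sum>a\<in>{a. a \<subseteq># s}. mps_coeff K a * (\<Sum>v | v \<in># m \<and> v \<ge> 1 \<and> size a \<le> count m v.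
          mps_coeff (colour_coeff H (s - a)) (m - replicate_mset (size a) v)))
      = (\<Sum>a\<in>{a. a \<subseteq># s}. \<Sum>v\<in>set_mset m. \<Sum>k=1..count m v. if size a = k then
          mps_coeff K a * mps_coeff (colour_term H (m - replicate_mset k v)) (s - a) else 0)"
    proof (intro sum.cong refl)
      fix a assume "a \<in> {a. a \<subseteq># s}"
      show "mps_coeff K a * (\<Sum>v | v \<in># m \<and> v \<ge> 1 \<and> size a \<le> count m v.
          mps_coeff (colour_coeff H (s - a)) (m - replicate_mset (size a) v))
        = (\<Sum>v\<in>set_mset m. \<Sum>k=1..count m v. if size a = k then
          mps_coeff K a * mps_coeff (colour_term H (m - replicate_mset k v)) (s - a) else 0)"
      proof (cases "a = {#}")
        case True
        then show ?thesis by (simp add: K)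
      next
        case a: False
        then have a1: "1 \<le> size a" by (simp add: Suc_le_eq nonempty_has_size)
        have "mps_coeff (colour_coeff H (s - a)) (m - replicate_mset (size a) v)
            = mps_coeff (colour_term H (m - replicate_mset (size a) v)) (s - a)" for v
          using False by (auto simp: colour_coeff.rep_eq dest: in_diffD)
        then have "mps_coeff K a * (\<Sum>v | v \<in># m \<and> v \<ge> 1 \<and> size a \<le> count m v.
            mps_coeff (colour_coeff H (s - a)) (m - replicate_mset (size a) v))
          = (\<Sum>v | v \<in># m \<and> v \<ge> 1 \<and> size a \<le> count m v. mps_coeff K a * ?T a v)"
          by (simp add: sum_distrib_left)
        also have "\<dots> = (\<Sum>v\<in>{v \<in> set_mset m. size a \<le> count m v}. mps_coeff K a * ?T a v)"
          using False by (intro sum.cong) (auto intro: Suc_leI gr0I)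
        also have "\<dots> = (\<Sum>v\<in>set_mset m. if size a \<le> count m v then mps_coeff K a * ?T a v else 0)"
          by (rule sum.inter_filter) simp
        also have "\<dots> = (\<Sum>v\<in>set_mset m. \<Sum>k=1..count m v. if size a = k then
          mps_coeff K a * mps_coeff (colour_term H (m - replicate_mset k v)) (s - a) else 0)"
          using a1 by (intro sum.cong refl) (simp add: sum.delta')
        finally show ?thesis .
      qed
    qed
    also have "\<dots> = (\<Sum>v\<in>set_mset m. \<Sum>k=1..count m v. \<Sum>a\<in>{a. a \<subseteq># s}. if size a = k then
          mps_coeff K a * mps_coeff (colour_term H (m - replicate_mset k v)) (s - a) else 0)"
      by (subst sum.swap, intro sum.cong refl, rule sum.swap)
    also have "\<dots> = mps_coeff (euler (colour_term H m)) s"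
      unfolding euler_colour_term[OF H ode] mps_coeff_sum
      by (intro sum.cong refl) (auto simp: times_mps.rep_eq component.rep_eq intro!: sum.cong)
    also have "\<dots> = mps_coeff (mps_coeff (euler (colour_product H)) s) m"
      using False by (simp add: euler.rep_eq colour_product.rep_eq colour_coeff.rep_eq)
    finally show ?thesis .
  qed
  finally show "mps_coeff (mps_coeff (euler (colour_product H)) s) m
    = mps_coeff (mps_coeff (power_sum_series K * colour_product H) s) m" ..
qed

text \<open>A nonempty \<open>z\<close>-monomial brings in a component of positive degree, which has
  no constant term.\<close>

lemma colour_product_empty:
  assumes H: "mps_coeff H {#} = 1"
  shows "mps_coeff (colour_product H) {#} = 1"
proof (rule mps_eqI)
  interpret h: comm_ring_hom "\<lambda>f :: ('a, rat) mps. mps_coeff f {#}"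
    by unfold_locales (simp_all add: mps_coeff_simps)
  fix m :: "nat multiset"
  have "mps_coeff (colour_term H m) {#} = (\<Prod>v\<in>set_mset m. mps_coeff (component (count m v) H) {#})"
    unfolding colour_term_def by (rule h.hom_prod)
  also have "\<dots> = (if m = {#} then 1 else 0)"
  proof (cases "m = {#}")
    case False
    then obtain v where "v \<in># m" by blast
    then have "mps_coeff (component (count m v) H) {#} = 0" by (simp add: component.rep_eq count_eq_zero_iff)
    with \<open>v \<in># m\<close> False show ?thesis by (auto intro!: prod_zero)
  qed simp
  finally show "mps_coeff (mps_coeff (colour_product H) {#}) m = mps_coeff 1 m"
    by (cases "m = {#}") (simp_all add: colour_product.rep_eq colour_coeff.rep_eq one_mps.rep_eq)
qed

section \<open>The Redei--Berge function as a product over colours\<close>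

text \<open>A change of colour cuts the word, and only steps within one colour are weighted. The
  value 0 for unequal lengths confines the word series to degree \<open>length c\<close>.\<close>

definition colour_weight :: "('v \<Rightarrow> 'v \<Rightarrow> 'a::comm_ring_1) \<Rightarrow> nat list \<Rightarrow> 'v list \<Rightarrow> 'a" where
  "colour_weight a c w = (if length c = length w
     then \<Prod>t<length w - 1. if c ! t = c ! Suc t then a (w ! t) (w ! Suc t) else 1 else 0)"

text \<open>As \<open>v\<close> does not recur in \<open>c\<close>, the step out of the leading
  block changes colour and has weight 1. The weight therefore factors at the end of the
  block.\<close>

lemma colour_weight_block:
  assumes v: "v \<notin> set c"
  shows "colour_weight a (replicate r v @ c) w
    = (if r \<le> length w then path_weight a (take r w) * colour_weight a c (drop r w) else 0)"
proof (cases "length w = r + length c")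
  case False
  then show ?thesis by (auto simp: colour_weight_def)
next
  case len: True
  let ?g = "\<lambda>t. if (replicate r v @ c) ! t = (replicate r v @ c) ! Suc t then a (w ! t) (w ! Suc t) else 1"
  have path: "path_weight a (take r w) = (\<Prod>t<r - 1. ?g t)"
    unfolding path_weight_def using len by (intro prod.cong) (auto simp: nth_append)
  have "colour_weight a c (drop r w) = (\<Prod>t<length c - 1. ?g (r + t))"
    unfolding colour_weight_def using len by (auto simp: nth_append intro!: prod.cong)
  also have "\<dots> = (\<Prod>t\<in>{r..<r + length c - 1}. ?g t)"
    by (rule prod.reindex_bij_witness[where i = "\<lambda>t. t - r" and j = "\<lambda>t. r + t"]) auto
  finally have rest: "colour_weight a c (drop r w) = (\<Prod>t\<in>{r..<r + length c - 1}. ?g t)" .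
  have "colour_weight a (replicate r v @ c) w = (\<Prod>t<r + length c - 1. ?g t)"
    using len by (simp add: colour_weight_def)
  also have "\<dots> = (\<Prod>t<r - 1. ?g t) * (\<Prod>t\<in>{r..<r + length c - 1}. ?g t)"
  proof (cases "r = 0 \<or> c = []")
    case True
    then show ?thesis by (auto simp: atLeast0LessThan)
  next
    case False
    then have "r > 0" "length c > 0" by auto
    then have lt: "r - 1 < r + length c - 1" and gt: "{r - 1<..<r + length c - 1} = {r..<r + length c - 1}"
      by (linarith, auto)
    have "c ! 0 \<noteq> v" using v False by (metis length_greater_0_conv nth_mem)
    then have "?g (r - 1) = 1" using False by (auto simp: nth_append)
    then show ?thesis unfolding prod_split_at[OF lt] gt by (simp only: mult_1_right)
  qed
  finally show ?thesis using len by (simp add: path rest)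
qed

text \<open>A product of word series concatenates words, and taking components fixes the length of
  each piece. Distinct colours keep neighbouring blocks apart.\<close>

lemma prod_components_path_series:
  "distinct vs \<Longrightarrow> (\<Prod>v\<in>set vs. component (r v) (word_series V (path_weight a)))
    = word_series V (colour_weight a (concat (map (\<lambda>v. replicate (r v) v) vs)))"
proof (induction vs)
  case Nil
  have "mps_coeff (word_series V (colour_weight a [])) s = mps_coeff 1 s" for s
    by (cases "s = {#}")
      (auto simp: word_series.rep_eq one_mps.rep_eq colour_weight_def dest: permutations_of_multisetD intro!: sum.neutral)
  then show ?case by (auto intro: mps_eqI)
next
  case (Cons v vs)
  let ?c = "concat (map (\<lambda>v. replicate (r v) v) vs)"
  have v: "v \<notin> set ?c" using Cons.prems by auto
  have "(\<Prod>v\<in>set (v # vs). component (r v) (word_series V (path_weight a)))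
    = word_series V (\<lambda>w. \<Sum>k\<le>length w. (if length (take k w) = r v then path_weight a (take k w) else 0)
        * colour_weight a ?c (drop k w))"
    using Cons by (simp add: component_word_series word_series_mult)
  also have "\<dots> = word_series V (colour_weight a (replicate (r v) v @ ?c))"
  proof (rule word_series_cong)
    fix w
    have "(\<Sum>k\<le>length w. (if length (take k w) = r v then path_weight a (take k w) else 0) * colour_weight a ?c (drop k w))
        = (\<Sum>k\<le>length w. if k = r v then path_weight a (take (r v) w) * colour_weight a ?c (drop (r v) w) else 0)"
      by (intro sum.cong refl) auto
    then show "(\<Sum>k\<le>length w. (if length (take k w) = r v then path_weight a (take k w) else 0)
        * colour_weight a ?c (drop k w)) = colour_weight a (replicate (r v) v @ ?c) w"
      by (simp add: colour_weight_block[OF v])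
  qed
  finally show ?case by simp
qed

lemma sorted_list_of_multiset_blocks:
  fixes m :: "'a::linorder multiset"
  shows "sorted_list_of_multiset m
    = concat (map (\<lambda>v. replicate (count m v) v) (sorted_list_of_set (set_mset m)))"
proof -
  let ?blocks = "\<lambda>vs. concat (map (\<lambda>v. replicate (count m v) v) vs)"
  have sorted: "sorted (?blocks vs)" if "sorted vs" for vs :: "'a list"
    using that by (induction vs) (auto simp: sorted_append)
  have count: "count (mset (?blocks vs)) u = (if u \<in> set vs then count m u else 0)" if "distinct vs" for vs u
    using that by (induction vs) auto
  have "mset (?blocks (sorted_list_of_set (set_mset m))) = m"
    by (rule multiset_eqI) (subst count, auto simp: not_in_iff)
  then show ?thesis
    by (metis sorted sorted_list_of_multiset_mset sorted_sort_id sorted_sorted_list_of_set)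
qed

lemma colour_term_path_series:
  "colour_term (word_series V (path_weight a)) m = word_series V (colour_weight a (sorted_list_of_multiset m))"
  using prod_components_path_series[of "sorted_list_of_set (set_mset m)" "count m" V a]
  by (simp add: colour_term_def sorted_list_of_multiset_blocks)

section \<open>Permutations as words, and their descents\<close>

lemma sum_permutes_eq_sum_permutations_of_set:
  "(\<Sum>\<pi> | \<pi> permutes {1..n}. f (map \<pi> [1..<Suc n])) = (\<Sum>w\<in>permutations_of_set {1..n}. f w)"
proof (rule sum.reindex_bij_witness[where j = "\<lambda>\<pi>. map \<pi> [1..<Suc n]"
      and i = "\<lambda>w x. if x \<in> {1..n} then w ! (x - 1) else x"], goal_cases)
  case (1 \<pi>)
  then have "\<pi> permutes {1..n}" by simp
  then show ?case
    by (auto simp: fun_eq_iff nth_append permutes_not_in simp del: upt_Suc)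
next
  case (2 \<pi>)
  then have "\<pi> permutes {1..n}" by simp
  then have "\<pi> ` {1..n} = {1..n}" "inj_on \<pi> {1..n}"
    by (simp_all add: permutes_image permutes_inj_on)
  then show ?case
    by (intro permutations_of_setI) (auto simp: distinct_map atLeastLessThanSuc_atLeastAtMost simp del: upt_Suc)
next
  case (3 w)
  then have "length w = n" by (simp add: length_finite_permutations_of_set)
  then show ?case by (intro nth_equalityI) (auto simp del: upt_Suc)
next
  case (4 w)
  then have w: "set w = {1..n}" "distinct w" "length w = n"
    by (auto dest: permutations_of_setD simp: length_finite_permutations_of_set)
  have "bij_betw (\<lambda>x. w ! (x - 1)) {1..n} {1..n}"
  proof (rule bij_betw_trans[of "\<lambda>x. x - 1" _ "{..<n}" "(!) w", unfolded comp_def])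
    show "bij_betw (\<lambda>x. x - 1) {1..n} {..<n}"
      by (rule bij_betw_byWitness[where f' = Suc]) auto
    show "bij_betw ((!) w) {..<n} {1..n}" using w by (intro bij_betw_nth) auto
  qed
  then have "bij_betw (\<lambda>x. if x \<in> {1..n} then w ! (x - 1) else x) {1..n} {1..n}"
    by (subst bij_betw_cong[where g = "\<lambda>x. w ! (x - 1)"]) auto
  then show ?case by (auto intro: bij_imp_permutes)
qed auto

definition non_edge :: "('v \<times> 'v) set \<Rightarrow> 'v \<Rightarrow> 'v \<Rightarrow> 'a::zero_neq_one" where
  "non_edge E x y = (if (x, y) \<in> E then 0 else 1)"

text \<open>A step along an edge within one colour makes the product 0, and all other steps
  contribute 1. The colours increase weakly, so different neighbouring colours means a strict
  increase, as \<open>F_qsym\<close> demands at descents.\<close>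

lemma colour_weight_descents:
  assumes "size m = n"
  shows "colour_weight (non_edge E) (sorted_list_of_multiset m) (map \<pi> [1..<Suc n])
    = (if \<forall>j\<in>Des n E \<pi>. sorted_index m j < sorted_index m (j + 1) then 1 else 0 :: rat)"
proof -
  let ?c = "sorted_list_of_multiset m"
  have len: "length ?c = n" using assms by (metis mset_sorted_list_of_multiset size_mset)
  define g where "g t = (if ?c ! t = ?c ! Suc t then non_edge E (\<pi> (Suc t)) (\<pi> (Suc (Suc t))) else 1 :: rat)" for t
  have le: "?c ! t \<le> ?c ! Suc t" if "t < n - 1" for t
    using that by (intro sorted_nth_mono) (auto simp: len)
  have "colour_weight (non_edge E) ?c (map \<pi> [1..<Suc n]) = (\<Prod>t<n - 1. g t)"
    unfolding colour_weight_def using len by (auto simp: g_def intro!: prod.cong simp del: upt_Suc)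
  also have "\<dots> = (if \<forall>t<n - 1. g t = 1 then 1 else 0)"
  proof (cases "\<forall>t<n - 1. g t = 1")
    case False
    then obtain t where "t < n - 1" "g t \<noteq> 1" by blast
    then have "g t = 0" by (auto simp: g_def non_edge_def split: if_splits)
    with \<open>t < n - 1\<close> False show ?thesis by (auto intro!: prod_zero)
  qed simp
  also have "(\<forall>t<n - 1. g t = 1) \<longleftrightarrow> (\<forall>j\<in>Des n E \<pi>. sorted_index m j < sorted_index m (j + 1))"
  proof
    assume g: "\<forall>t<n - 1. g t = 1"
    show "\<forall>j\<in>Des n E \<pi>. sorted_index m j < sorted_index m (j + 1)"
    proof
      fix j assume j: "j \<in> Des n E \<pi>"
      then obtain t where t: "j = Suc t" "t < n - 1" "(\<pi> (Suc t), \<pi> (Suc (Suc t))) \<in> E"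
        by (cases j) (auto simp: Des_def)
      with g have "?c ! t \<noteq> ?c ! Suc t" by (auto simp: g_def non_edge_def split: if_splits)
      with le[OF t(2)] show "sorted_index m j < sorted_index m (j + 1)"
        using t by (simp add: sorted_index_def assms)
    qed
  next
    assume d: "\<forall>j\<in>Des n E \<pi>. sorted_index m j < sorted_index m (j + 1)"
    show "\<forall>t<n - 1. g t = 1"
    proof (intro allI impI)
      fix t assume t: "t < n - 1"
      show "g t = 1"
      proof (cases "(\<pi> (Suc t), \<pi> (Suc (Suc t))) \<in> E")
        case True
        then have "Suc t \<in> Des n E \<pi>" using t by (auto simp: Des_def)
        with d have "sorted_index m (Suc t) < sorted_index m (Suc t + 1)" by blast
        moreover have "Suc t \<le> n" "Suc (Suc t) \<le> n" using t by auto
        ultimately have "?c ! t < ?c ! Suc t" by (simp add: sorted_index_def assms)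
        then show ?thesis by (simp add: g_def)
      qed (simp add: g_def non_edge_def)
    qed
  qed
  finally show ?thesis .
qed

text \<open>For a fixed \<open>z\<close>-monomial the index sequence is forced, and the permutations
  compatible with it are counted by \<open>colour_weight\<close>. Their words are exactly the words
  of the square-free monomial in all the vertices.\<close>

lemma redei_berge_colour_product:
  "redei_berge n E = multilinear_coeff n (colour_product (word_series {1..n} (path_weight (non_edge E))))"
proof (rule mps_eqI)
  fix m :: "nat multiset"
  have "mps_coeff (redei_berge n E) m = (\<Sum>\<pi> | \<pi> permutes {1..n}.
      if size m = n \<and> 0 \<notin># m \<and> (\<forall>j\<in>Des n E \<pi>. sorted_index m j < sorted_index m (j + 1)) then 1 else 0)"
    unfolding redei_berge_def mps_coeff_sum F_qsym_def mps_coeff_index_sum ..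
  also have "\<dots> = (if 0 \<in># m then 0 else \<Sum>\<pi> | \<pi> permutes {1..n}.
      colour_weight (non_edge E) (sorted_list_of_multiset m) (map \<pi> [1..<Suc n]))"
  proof (cases "size m = n")
    case True
    then show ?thesis by (simp only: colour_weight_descents[OF True]) simp
  next
    case False
    then have "length (sorted_list_of_multiset m) \<noteq> n" by (metis mset_sorted_list_of_multiset size_mset)
    with False show ?thesis by (simp add: colour_weight_def del: upt_Suc)
  qed
  also have "\<dots> = (if 0 \<in># m then 0 else \<Sum>w\<in>permutations_of_set {1..n}.
      colour_weight (non_edge E) (sorted_list_of_multiset m) w)"
    by (simp only: sum_permutes_eq_sum_permutations_of_set)
  also have "\<dots> = mps_coeff (multilinear_coeff n (colour_product (word_series {1..n} (path_weight (non_edge E))))) m"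
    by (simp add: multilinear_coeff_def colour_product.rep_eq colour_coeff.rep_eq colour_term_path_series
        word_series.rep_eq permutations_of_set_altdef)
  finally show "mps_coeff (redei_berge n E) m
    = mps_coeff (multilinear_coeff n (colour_product (word_series {1..n} (path_weight (non_edge E))))) m" .
qed

section \<open>Traces as sums over closed walks\<close>

text \<open>The letters of \<open>w\<close> are the starting points of the steps; the endpoint
  \<open>j\<close> is not recorded, because in the product of \<open>X\<close> with a matrix each
  step carries the variable of its row. Using \<open>hd (w @ [j])\<close> makes the empty walk
  require \<open>i = j\<close>.\<close>

definition walk_weight :: "('v \<Rightarrow> 'v \<Rightarrow> 'a::comm_ring_1) \<Rightarrow> 'v \<Rightarrow> 'v \<Rightarrow> 'v list \<Rightarrow> 'a" where
  "walk_weight a i j w = (if hd (w @ [j]) = i then \<Prod>t<length w. a (w ! t) ((w @ [j]) ! Suc t) else 0)"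

lemma walk_weight_snoc: "walk_weight a i j (u @ [l]) = walk_weight a i l u * a l j"
proof -
  have "(\<Prod>t<length u. a ((u @ [l]) ! t) ((u @ [l, j]) ! Suc t)) = (\<Prod>t<length u. a (u ! t) ((u @ [l]) ! Suc t))"
    by (intro prod.cong) (auto simp: nth_append)
  then show ?thesis by (cases u) (auto simp: walk_weight_def nth_append)
qed

lemma walk_weight_closed: "w \<noteq> [] \<Longrightarrow> walk_weight a i i w = (if hd w = i then cycle_weight a w else 0)"
proof -
  assume w: "w \<noteq> []"
  have "(w @ [hd w]) ! Suc t = w ! (Suc t mod length w)" if "t < length w" for t
  proof (cases "Suc t = length w")
    case True
    then show ?thesis using w by (simp add: nth_append hd_conv_nth)
  next
    case False
    then show ?thesis using that by (simp add: nth_append)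
  qed
  then show ?thesis using w by (auto simp: walk_weight_def cycle_weight_def)
qed

section \<open>Entries, powers and traces as word series\<close>

definition weight_mat :: "nat \<Rightarrow> (nat \<Rightarrow> nat \<Rightarrow> rat) \<Rightarrow> xseries mat" where
  "weight_mat n a = mat n n (\<lambda>(i, j). mps_const (mps_const (a (Suc i) (Suc j))))"

lemma X_weight_mat_carrier: "X_mat n * weight_mat n a \<in> carrier_mat n n"
  by (rule mult_carrier_mat[of _ n n]) (simp_all add: X_mat_def weight_mat_def)

lemma mps_coeff_word_series_single:
  "mps_coeff (word_series V (\<lambda>w. if w = u then c else 0)) s = (if s = mset u \<and> set u \<subseteq> V then c else 0)"
proof -
  have "u \<in> permutations_of_multiset s \<longleftrightarrow> s = mset u" by (auto simp: permutations_of_multiset_def)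
  then show ?thesis by (auto simp: word_series.rep_eq)
qed

lemma X_weight_mat_index:
  assumes "i < n" "j < n"
  shows "(X_mat n * weight_mat n a) $$ (i, j)
    = word_series {1..n} (\<lambda>w. if w = [Suc i] then mps_const (a (Suc i) (Suc j)) else 0)"
proof -
  have "weight_mat n a \<in> carrier_mat n n" by (simp add: weight_mat_def)
  then have "(X_mat n * weight_mat n a) $$ (i, j) = mps_var (Suc i) * mps_const (mps_const (a (Suc i) (Suc j)))"
    using assms by (simp add: X_mat_def mat_diag_mult_left) (simp add: weight_mat_def)
  also have "\<dots> = word_series {1..n} (\<lambda>w. if w = [Suc i] then mps_const (a (Suc i) (Suc j)) else 0)"
  proof (rule mps_eqI)
    fix s
    show "mps_coeff (mps_var (Suc i) * mps_const (mps_const (a (Suc i) (Suc j)))) s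
      = mps_coeff (word_series {1..n} (\<lambda>w. if w = [Suc i] then mps_const (a (Suc i) (Suc j)) else 0)) s"
      using assms by (auto simp: mult.commute[of "mps_var _"] mps_var.rep_eq mps_coeff_word_series_single)
  qed
  finally show ?thesis .
qed

lemma homogeneous_X_weight_mat:
  assumes "i < n" "j < n"
  shows "homogeneous 1 ((X_mat n * weight_mat n a) $$ (i, j))"
  unfolding homogeneous_def X_weight_mat_index[OF assms] mps_coeff_word_series_single by auto

lemma sum_word_series:
  "(\<Sum>i\<in>A. word_series V (\<phi> i)) = word_series V (\<lambda>w. \<Sum>i\<in>A. \<phi> i w)"
proof (rule mps_eqI)
  fix s
  show "mps_coeff (\<Sum>i\<in>A. word_series V (\<phi> i)) s = mps_coeff (word_series V (\<lambda>w. \<Sum>i\<in>A. \<phi> i w)) s"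
    using sum.swap[of "\<lambda>i w. \<phi> i w" "permutations_of_multiset s" A]
    by (cases "set_mset s \<subseteq> V") (simp_all add: mps_coeff_sum word_series.rep_eq)
qed

text \<open>One more matrix factor appends one letter. In the product of word series only the cut
  before the last letter counts, and that letter names the intermediate vertex.\<close>

lemma X_weight_mat_pow:
  assumes "i < n" "j < n"
  shows "((X_mat n * weight_mat n a) ^\<^sub>m k) $$ (i, j)
    = word_series {1..n} (\<lambda>w. if length w = k then mps_const (walk_weight a (Suc i) (Suc j) w) else 0)"
  using assms
proof (induction k arbitrary: j)
  case 0
  have "(if i = j then 1 else 0 :: xseries) = word_series {1..n} (\<lambda>w. if w = [] then if i = j then 1 else 0 else 0)"
    by (rule mps_eqI) (auto simp: mps_coeff_word_series_single one_mps.rep_eq zero_mps.rep_eq)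
  also have "\<dots> = word_series {1..n} (\<lambda>w. if length w = 0 then mps_const (walk_weight a (Suc i) (Suc j) w) else 0)"
    by (rule word_series_cong) (auto simp: walk_weight_def)
  finally show ?case
    using 0 by (simp add: carrier_matD(1)[OF X_weight_mat_carrier] del: index_mult_mat(2,3))
next
  case (Suc k)
  let ?M = "X_mat n * weight_mat n a"
  have M: "?M \<in> carrier_mat n n" "?M ^\<^sub>m k \<in> carrier_mat n n" using X_weight_mat_carrier by simp_all
  have "(B * C) $$ (i, j) = (\<Sum>l<n. B $$ (i, l) * C $$ (l, j))"
    if "B \<in> carrier_mat n n" "C \<in> carrier_mat n n" for B C :: "xseries mat"
    using that Suc.prems by (simp add: scalar_prod_def atLeast0LessThan)
  from this[OF M(2,1)] have "(?M ^\<^sub>m Suc k) $$ (i, j) = (\<Sum>l<n. (?M ^\<^sub>m k) $$ (i, l) * ?M $$ (l, j))"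
    by simp
  also have "\<dots> = (\<Sum>l<n. word_series {1..n} (\<lambda>w. \<Sum>p\<le>length w.
      (if length (take p w) = k then mps_const (walk_weight a (Suc i) (Suc l) (take p w)) else 0)
      * (if drop p w = [Suc l] then mps_const (a (Suc l) (Suc j)) else 0)))"
    by (intro sum.cong refl) (simp add: Suc.IH Suc.prems X_weight_mat_index word_series_mult)
  also have "\<dots> = word_series {1..n} (\<lambda>w. \<Sum>l<n. \<Sum>p\<le>length w.
      (if length (take p w) = k then mps_const (walk_weight a (Suc i) (Suc l) (take p w)) else 0)
      * (if drop p w = [Suc l] then mps_const (a (Suc l) (Suc j)) else 0))"
    by (rule sum_word_series)
  also have "\<dots> = word_series {1..n} (\<lambda>w. if length w = Suc k then mps_const (walk_weight a (Suc i) (Suc j) w) else 0)"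
  proof (rule word_series_cong)
    fix w :: "nat list" assume w: "set w \<subseteq> {1..n}"
    let ?x = "\<lambda>l p. (if length (take p w) = k then mps_const (walk_weight a (Suc i) (Suc l) (take p w)) else 0)
      * (if drop p w = [Suc l] then mps_const (a (Suc l) (Suc j)) else 0) :: zseries"
    show "(\<Sum>l<n. \<Sum>p\<le>length w. ?x l p) = (if length w = Suc k then mps_const (walk_weight a (Suc i) (Suc j) w) else 0)"
    proof (cases "length w = Suc k")
      case True
      then obtain u x where ux: "w = u @ [x]" "length u = k" by (metis length_Suc_conv_rev)
      then obtain l where l: "x = Suc l" "l < n" using w by (cases x) auto
      have inner: "(\<Sum>p\<le>length w. ?x l' p) = (if l' = l then mps_const (walk_weight a (Suc i) (Suc j) w) else 0)" for l'
      proof -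
        have "?x l' p = (if p = k \<and> l' = l then mps_const (walk_weight a (Suc i) (Suc j) w) else 0)" if "p \<le> length w" for p
          using that by (auto simp: ux l walk_weight_snoc mps_const_mult)
        then have "(\<Sum>p\<le>length w. ?x l' p) = (\<Sum>p\<le>length w. if p = k then if l' = l then mps_const (walk_weight a (Suc i) (Suc j) w) else 0 else 0)"
          by (intro sum.cong refl) auto
        then show ?thesis by (simp add: ux)
      qed
      show ?thesis unfolding inner using l True by simp
    next
      case False
      have "?x l p = 0" if "p \<le> length w" for l p
      proof -
        have "\<not> (length (take p w) = k \<and> drop p w = [Suc l])"
          using False that by (metis append_take_drop_id length_append_singleton)
        then show ?thesis by auto
      qed
      then have "(\<Sum>l<n. \<Sum>p\<le>length w. ?x l p) = 0" by (intro sum.neutral ballI) simp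
      then show ?thesis using False by simp
    qed
  qed
  finally show ?case .
qed

text \<open>A closed walk starts at its first letter, so the sum over the diagonal meets every word
  once. For \<open>k = 0\<close> the trace is \<open>n\<close>, whereas the empty word would count
  only once.\<close>

lemma trace_X_weight_mat_pow:
  assumes "k > 0"
  shows "trace_mat ((X_mat n * weight_mat n a) ^\<^sub>m k)
    = word_series {1..n} (\<lambda>w. if length w = k then mps_const (cycle_weight a w) else 0)"
proof -
  have "trace_mat ((X_mat n * weight_mat n a) ^\<^sub>m k) = word_series {1..n} (\<lambda>w. \<Sum>i<n.
      if length w = k then mps_const (walk_weight a (Suc i) (Suc i) w) else 0)"
  proof -
    have "(X_mat n * weight_mat n a) ^\<^sub>m k \<in> carrier_mat n n"
      using X_weight_mat_carrier by (rule pow_carrier_mat)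
    then show ?thesis
      by (simp only: trace_mat_sum sum_word_series[symmetric]) (intro sum.cong refl, simp only: X_weight_mat_pow lessThan_iff)
  qed
  also have "\<dots> = word_series {1..n} (\<lambda>w. if length w = k then mps_const (cycle_weight a w) else 0)"
  proof (rule word_series_cong)
    fix w :: "nat list" assume w: "set w \<subseteq> {1..n}"
    show "(\<Sum>i<n. if length w = k then mps_const (walk_weight a (Suc i) (Suc i) w) else 0)
        = (if length w = k then mps_const (cycle_weight a w) else 0 :: zseries)"
    proof (cases "length w = k")
      case True
      then have "w \<noteq> []" using assms by auto
      then obtain l where l: "hd w = Suc l" "l < n" using w by (cases w; cases "hd w") auto
      have "(\<Sum>i<n. mps_const (walk_weight a (Suc i) (Suc i) w)) = (\<Sum>i<n. if l = i then mps_const (cycle_weight a w) else 0 :: zseries)"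
        using \<open>w \<noteq> []\<close> l by (intro sum.cong refl) (simp add: walk_weight_closed)
      then show ?thesis using True l by simp
    qed simp
  qed
  finally show ?thesis .
qed

text \<open>At a given monomial both the sign and the power sum depend only on the degree, which is
  the word length. The condition on \<open>\<epsilon> 0\<close> removes degree 0, where the trace
  formula fails.\<close>

lemma power_sum_series_traces:
  assumes "\<epsilon> 0 = 0"
  shows "graded_sum (\<lambda>k. mps_const (mps_const (\<epsilon> k) * p_sym k) * trace_mat ((X_mat n * weight_mat n a) ^\<^sub>m k))
    = power_sum_series (word_series {1..n} (\<lambda>w. \<epsilon> (length w) * cycle_weight a w))"
proof (rule mps_eqI)
  fix s :: "nat multiset"
  have "(\<Sum>w\<in>permutations_of_multiset s. if length w = size s then mps_const (cycle_weight a w) else 0)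
      = (mps_const (\<Sum>w\<in>permutations_of_multiset s. cycle_weight a w) :: zseries)"
    unfolding mps_const_sum by (intro sum.cong refl) (simp add: length_permutations_of_multiset)
  moreover have "(\<Sum>w\<in>permutations_of_multiset s. \<epsilon> (length w) * cycle_weight a w)
      = \<epsilon> (size s) * (\<Sum>w\<in>permutations_of_multiset s. cycle_weight a w)"
    unfolding sum_distrib_left by (intro sum.cong refl) (simp add: length_permutations_of_multiset)
  ultimately have *: "mps_const (\<epsilon> k) * p_sym k * mps_coeff (word_series {1..n} (\<lambda>w. if length w = k then mps_const (cycle_weight a w) else 0)) s
      = mps_const (mps_coeff (word_series {1..n} (\<lambda>w. \<epsilon> (length w) * cycle_weight a w)) s) * p_sym k"
    if "k = size s" for k
    using that by (simp add: word_series.rep_eq mps_const_mult)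
  show "mps_coeff (graded_sum (\<lambda>k. mps_const (mps_const (\<epsilon> k) * p_sym k) * trace_mat ((X_mat n * weight_mat n a) ^\<^sub>m k))) s
      = mps_coeff (power_sum_series (word_series {1..n} (\<lambda>w. \<epsilon> (length w) * cycle_weight a w))) s"
  proof (cases "size s = 0")
    case True
    then show ?thesis using assms by (simp add: graded_sum.rep_eq power_sum_series.rep_eq word_series.rep_eq)
  next
    case False
    then have "size s > 0" by linarith
    from trace_X_weight_mat_pow[OF this] show ?thesis
      by (simp only: graded_sum.rep_eq power_sum_series.rep_eq mps_coeff_const_mult *)
  qed
qed

section \<open>Splitting a cycle off a permutation\<close>

context
  fixes S :: "'v set" and xs :: "'v list" and \<tau> :: "'v \<Rightarrow> 'v"
  assumes fin: "finite S" and xs: "distinct xs" "xs \<noteq> []" "set xs \<subseteq> S"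
    and \<tau>: "\<tau> permutes S - set xs"
begin

lemma cycle_comp_permutes: "cycle_of_list xs \<circ> \<tau> permutes S"
  using xs(3) by (intro permutes_compose permutes_subset[OF \<tau>] permutes_subset[OF cycle_permutes]) auto

lemma permutation_cycle_comp: "permutation (cycle_of_list xs \<circ> \<tau>)"
  using cycle_comp_permutes fin by (auto simp: permutation_permutes)

lemma cycle_of_list_nth: "t < length xs \<Longrightarrow> cycle_of_list xs (xs ! t) = xs ! (Suc t mod length xs)"
proof -
  assume t: "t < length xs"
  have "map (cycle_of_list xs) xs = rotate1 xs"
    using cyclic_rotation[OF xs(1), of 1] by simp
  then have "map (cycle_of_list xs) xs ! t = rotate1 xs ! t" by simp
  then show ?thesis using t by (simp add: nth_rotate1)
qed

lemma cycle_comp_on_cycle: "x \<in> set xs \<Longrightarrow> (cycle_of_list xs \<circ> \<tau>) x = cycle_of_list xs x"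
  using permutes_not_in[OF \<tau>, of x] by simp

lemma cycle_comp_off_cycle: "x \<notin> set xs \<Longrightarrow> (cycle_of_list xs \<circ> \<tau>) x = \<tau> x"
proof -
  assume "x \<notin> set xs"
  then have "\<tau> x \<notin> set xs" using permutes_in_image[OF \<tau>, of x] permutes_not_in[OF \<tau>, of x] by fastforce
  then show ?thesis by (simp add: id_outside_supp)
qed

lemma cycle_comp_funpow: "((cycle_of_list xs \<circ> \<tau>) ^^ t) (hd xs) = xs ! (t mod length xs)"
proof (induction t)
  case 0
  then show ?case using xs by (simp add: hd_conv_nth)
next
  case (Suc t)
  have "t mod length xs < length xs" using xs(2) by simp
  then show ?case
    using Suc cycle_comp_on_cycle[of "xs ! (t mod length xs)"] cycle_of_list_nth[of "t mod length xs"]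
    by (simp add: mod_Suc_eq)
qed

lemma least_power_cycle_comp: "least_power (cycle_of_list xs \<circ> \<tau>) (hd xs) = length xs"
proof (rule antisym)
  let ?\<sigma> = "cycle_of_list xs \<circ> \<tau>"
  have "(?\<sigma> ^^ length xs) (hd xs) = hd xs"
    unfolding cycle_comp_funpow using xs(2) by (simp add: hd_conv_nth)
  then show "least_power ?\<sigma> (hd xs) \<le> length xs" using xs(2) by (intro least_power_le) auto
  have "xs ! (least_power ?\<sigma> (hd xs) mod length xs) = xs ! 0"
    using least_power_of_permutation(1)[OF permutation_cycle_comp, of "hd xs"] xs(2)
    unfolding cycle_comp_funpow by (simp add: hd_conv_nth)
  then have "least_power ?\<sigma> (hd xs) mod length xs = 0"
    using nth_eq_iff_index_eq[OF xs(1)] xs(2) by simp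
  then show "length xs \<le> least_power ?\<sigma> (hd xs)"
    using least_power_of_permutation(2)[OF permutation_cycle_comp, of "hd xs"] by (meson dvd_imp_le mod_0_imp_dvd)
qed

text \<open>This makes the splitting invertible: the list \<open>xs\<close> is recovered by
  iterating the permutation from the first letter.\<close>

lemma support_cycle_comp: "support (cycle_of_list xs \<circ> \<tau>) (hd xs) = xs"
  unfolding least_power_cycle_comp cycle_comp_funpow by (rule nth_equalityI) auto

lemma orbit_cycle_comp_on: "x \<in> set xs \<Longrightarrow> orbit (cycle_of_list xs \<circ> \<tau>) x = set xs"
proof -
  let ?\<sigma> = "cycle_of_list xs \<circ> \<tau>"
  assume x: "x \<in> set xs"
  have "set xs = orbit ?\<sigma> (hd xs)"
    using support_set[OF permutation_cycle_comp, of "hd xs"]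
    unfolding support_cycle_comp orbit_altdef_permutation[OF permutation_cycle_comp] by auto
  then have "cyclic_on ?\<sigma> (set xs)" using xs(2) by (auto simp: cyclic_on_def)
  then show ?thesis using x by (rule orbit_cyclic_eq3)
qed

lemma orbit_cycle_comp_off:
  assumes "x \<in> S - set xs"
  shows "orbit (cycle_of_list xs \<circ> \<tau>) x = orbit \<tau> x"
  using assms
proof (rule orbit_cong0[symmetric])
  show "\<tau> \<in> S - set xs \<rightarrow> S - set xs" using permutes_in_image[OF \<tau>] by blast
  show "\<tau> y = (cycle_of_list xs \<circ> \<tau>) y" if "y \<in> S - set xs" for y
    using cycle_comp_off_cycle[of y] that by simp
qed

text \<open>\<open>p_cyc\<close> is a product over the set of orbits, so the second claim is what
  makes the new cycle an additional factor.\<close>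

lemma orbits_cycle_comp:
  "orbit (cycle_of_list xs \<circ> \<tau>) ` S = insert (set xs) (orbit \<tau> ` (S - set xs))"
  "set xs \<notin> orbit \<tau> ` (S - set xs)"
proof -
  have "S = set xs \<union> (S - set xs)" using xs(3) by auto
  then have "orbit (cycle_of_list xs \<circ> \<tau>) ` S
      = orbit (cycle_of_list xs \<circ> \<tau>) ` set xs \<union> orbit (cycle_of_list xs \<circ> \<tau>) ` (S - set xs)"
    by (metis image_Un)
  also have "orbit (cycle_of_list xs \<circ> \<tau>) ` set xs = {set xs}"
    using xs(2) by (simp add: orbit_cycle_comp_on image_constant_conv cong: image_cong)
  also have "orbit (cycle_of_list xs \<circ> \<tau>) ` (S - set xs) = orbit \<tau> ` (S - set xs)"
    by (intro image_cong refl orbit_cycle_comp_off)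
  finally show "orbit (cycle_of_list xs \<circ> \<tau>) ` S = insert (set xs) (orbit \<tau> ` (S - set xs))"
    by (simp only: Un_insert_left Un_empty_left)
  have "permutation \<tau>" using \<tau> fin by (auto simp: permutation_permutes)
  then show "set xs \<notin> orbit \<tau> ` (S - set xs)"
    using permutation_self_in_orbit by fastforce
qed

lemma prod_cycle_comp:
  "(\<Prod>i\<in>S. a i ((cycle_of_list xs \<circ> \<tau>) i)) = cycle_weight a xs * (\<Prod>i\<in>S - set xs. a i (\<tau> i))"
proof -
  have "(\<Prod>i\<in>S. a i ((cycle_of_list xs \<circ> \<tau>) i))
      = (\<Prod>i\<in>S - set xs. a i ((cycle_of_list xs \<circ> \<tau>) i)) * (\<Prod>i\<in>set xs. a i ((cycle_of_list xs \<circ> \<tau>) i))"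
    using xs(3) fin by (rule prod.subset_diff)
  also have "(\<Prod>i\<in>S - set xs. a i ((cycle_of_list xs \<circ> \<tau>) i)) = (\<Prod>i\<in>S - set xs. a i (\<tau> i))"
    by (intro prod.cong refl arg_cong2[where f = a] cycle_comp_off_cycle) auto
  also have "(\<Prod>i\<in>set xs. a i ((cycle_of_list xs \<circ> \<tau>) i)) = (\<Prod>i\<in>set xs. a i (cycle_of_list xs i))"
    by (intro prod.cong refl) (simp only: cycle_comp_on_cycle)
  also have "\<dots> = cycle_weight a xs"
  proof -
    have "bij_betw ((!) xs) {..<length xs} (set xs)" using xs(1) by (intro bij_betw_nth) auto
    then have "(\<Prod>i\<in>set xs. a i (cycle_of_list xs i)) = (\<Prod>t<length xs. a (xs ! t) (cycle_of_list xs (xs ! t)))"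
      by (rule prod.reindex_bij_betw[symmetric])
    then show ?thesis by (simp add: cycle_weight_def cycle_of_list_nth)
  qed
  finally show ?thesis by (simp add: mult.commute)
qed

end

lemma sign_cycle_of_list: "distinct xs \<Longrightarrow> sign (cycle_of_list xs) = (- 1) ^ (length xs - 1)"
  by (induction xs rule: cycle_of_list.induct)
    (auto simp: sign_compose permutation_swap_id permutation_of_cycle sign_swap_id)

lemma p_cyc_cycle_comp:
  fixes S :: "nat set"
  assumes "finite S" "distinct xs" "xs \<noteq> []" "set xs \<subseteq> S" "\<tau> permutes S - set xs"
  shows "p_cyc S (cycle_of_list xs \<circ> \<tau>) = p_sym (length xs) * p_cyc (S - set xs) \<tau>"
  unfolding p_cyc_def orbits_cycle_comp(1)[OF assms]
  using orbits_cycle_comp(2)[OF assms] assms by (simp add: distinct_card)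

text \<open>
  Counting pairs of a permutation and a marked point: the marked point names the first letter of
  the cycle that is split off.
\<close>

lemma cycle_cover_recursion:
  fixes S :: "'v set" and f :: "'v set \<Rightarrow> ('v \<Rightarrow> 'v) \<Rightarrow> 'a::comm_ring_1"
  assumes fin: "finite S"
    and f: "\<And>xs \<tau>. distinct xs \<Longrightarrow> xs \<noteq> [] \<Longrightarrow> set xs \<subseteq> S \<Longrightarrow> \<tau> permutes S - set xs \<Longrightarrow>
      f S (cycle_of_list xs \<circ> \<tau>) = g xs * f (S - set xs) \<tau>"
  shows "of_nat (card S) * (\<Sum>\<sigma> | \<sigma> permutes S. f S \<sigma>)
    = (\<Sum>T\<in>Pow S - {{}}. (\<Sum>xs\<in>permutations_of_set T. g xs) * (\<Sum>\<tau> | \<tau> permutes S - T. f (S - T) \<tau>))"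
proof -
  let ?L = "{xs. distinct xs \<and> xs \<noteq> [] \<and> set xs \<subseteq> S}"
  let ?P = "\<lambda>S. {\<sigma>. \<sigma> permutes S}"
  \<comment> \<open>The permutation \<sigma> with the cycle through the marked point
    \<open>i\<close> replaced by fixed points.\<close>
  let ?rest = "\<lambda>i \<sigma> y. if y \<in> S - set (support \<sigma> i) then \<sigma> y else y"
  have "of_nat (card S) * (\<Sum>\<sigma>\<in>?P S. f S \<sigma>) = (\<Sum>(i, \<sigma>)\<in>S \<times> ?P S. f S \<sigma>)"
    by (simp add: sum.cartesian_product[symmetric])
  also have "\<dots> = (\<Sum>(xs, \<tau>)\<in>Sigma ?L (\<lambda>xs. ?P (S - set xs)). g xs * f (S - set xs) \<tau>)"
  proof (rule sum.reindex_bij_witness[where i = "\<lambda>(xs, \<tau>). (hd xs, cycle_of_list xs \<circ> \<tau>)"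
        and j = "\<lambda>(i, \<sigma>). (support \<sigma> i, ?rest i \<sigma>)"])
    fix i\<sigma> assume "i\<sigma> \<in> S \<times> ?P S"
    then obtain i \<sigma> where i\<sigma>: "i\<sigma> = (i, \<sigma>)" "i \<in> S" "\<sigma> permutes S" by auto
    have perm: "permutation \<sigma>" using i\<sigma> fin by (auto simp: permutation_permutes)
    have pos: "least_power \<sigma> i > 0" by (rule least_power_of_permutation(2)[OF perm])
    have funpow: "(\<sigma> ^^ t) x \<in> S" if "x \<in> S" for t x
      using that by (induction t) (use permutes_in_image[OF i\<sigma>(3)] in auto)
    define xs where "xs = support \<sigma> i"
    have xs: "distinct xs" "xs \<noteq> []" "set xs \<subseteq> S"
      using cycle_of_permutation[OF perm] pos funpow i\<sigma>(2) unfolding xs_def by auto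
    have hd: "hd xs = i" using pos by (simp add: xs_def hd_map)
    have rest: "?rest i \<sigma> permutes S - set xs"
      unfolding xs_def by (rule semidecomposition[OF i\<sigma>(3) fin])
    have comp: "cycle_of_list xs \<circ> ?rest i \<sigma> = \<sigma>"
    proof
      fix x
      show "(cycle_of_list xs \<circ> ?rest i \<sigma>) x = \<sigma> x"
      proof (cases "x \<in> set xs")
        case True
        then show ?thesis
          using cycle_comp_on_cycle[OF fin xs rest True] cycle_restrict[OF perm, of x i] by (simp add: xs_def)
      next
        case False
        then have "(cycle_of_list xs \<circ> ?rest i \<sigma>) x = ?rest i \<sigma> x"
          by (rule cycle_comp_off_cycle[OF fin xs rest])
        then show ?thesis using False permutes_not_in[OF i\<sigma>(3), of x] by (auto simp: xs_def)
      qed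
    qed
    show "(case case i\<sigma> of (i, \<sigma>) \<Rightarrow> (support \<sigma> i, ?rest i \<sigma>) of (xs, \<tau>) \<Rightarrow> (hd xs, cycle_of_list xs \<circ> \<tau>)) = i\<sigma>"
      using comp hd unfolding xs_def i\<sigma>(1) by (simp only: prod.case)
    show "(case i\<sigma> of (i, \<sigma>) \<Rightarrow> (support \<sigma> i, ?rest i \<sigma>)) \<in> Sigma ?L (\<lambda>xs. ?P (S - set xs))"
      using xs rest unfolding xs_def i\<sigma>(1) by (simp only: prod.case mem_Sigma_iff mem_Collect_eq) blast
    show "(case case i\<sigma> of (i, \<sigma>) \<Rightarrow> (support \<sigma> i, ?rest i \<sigma>) of (xs, \<tau>) \<Rightarrow> g xs * f (S - set xs) \<tau>)
        = (case i\<sigma> of (i, \<sigma>) \<Rightarrow> f S \<sigma>)"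
      using f[OF xs rest] unfolding comp unfolding xs_def i\<sigma>(1) by (simp only: prod.case)
  next
    fix xs\<tau> assume "xs\<tau> \<in> Sigma ?L (\<lambda>xs. ?P (S - set xs))"
    then obtain xs \<tau> where xs\<tau>: "xs\<tau> = (xs, \<tau>)"
      and xs: "distinct xs" "xs \<noteq> []" "set xs \<subseteq> S" and \<tau>: "\<tau> permutes S - set xs" by auto
    note supp = support_cycle_comp[OF fin xs \<tau>]
    have "?rest (hd xs) (cycle_of_list xs \<circ> \<tau>) = \<tau>"
    proof
      fix y
      show "?rest (hd xs) (cycle_of_list xs \<circ> \<tau>) y = \<tau> y"
      proof (cases "y \<in> S - set xs")
        case True
        then show ?thesis unfolding supp using cycle_comp_off_cycle[OF fin xs \<tau>, of y] by simp
      next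
        case False
        then show ?thesis unfolding supp using permutes_not_in[OF \<tau> False] by (simp only: if_False)
      qed
    qed
    then show "(case case xs\<tau> of (xs, \<tau>) \<Rightarrow> (hd xs, cycle_of_list xs \<circ> \<tau>) of (i, \<sigma>) \<Rightarrow> (support \<sigma> i, ?rest i \<sigma>)) = xs\<tau>"
      unfolding xs\<tau> prod.case by (simp only: supp)
    show "(case xs\<tau> of (xs, \<tau>) \<Rightarrow> (hd xs, cycle_of_list xs \<circ> \<tau>)) \<in> S \<times> ?P S"
      using cycle_comp_permutes[OF fin xs \<tau>] xs unfolding xs\<tau> prod.case by auto
  qed
  also have "\<dots> = (\<Sum>xs\<in>?L. g xs * (\<Sum>\<tau>\<in>?P (S - set xs). f (S - set xs) \<tau>))"
  proof -
    have "?L \<subseteq> (\<Union>T\<in>Pow S. permutations_of_set T)" by (auto intro: permutations_of_setI)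
    then have "finite ?L" by (rule finite_subset) (use fin in auto)
    then show ?thesis unfolding sum_distrib_left
      by (subst sum.Sigma) (auto simp: fin finite_permutations)
  qed
  also have "\<dots> = (\<Sum>(T, xs)\<in>Sigma (Pow S - {{}}) permutations_of_set.
      g xs * (\<Sum>\<tau>\<in>?P (S - T). f (S - T) \<tau>))"
    by (rule sum.reindex_bij_witness[where i = snd and j = "\<lambda>xs. (set xs, xs)"])
      (auto simp: permutations_of_set_def)
  also have "\<dots> = (\<Sum>T\<in>Pow S - {{}}. (\<Sum>xs\<in>permutations_of_set T. g xs) * (\<Sum>\<tau>\<in>?P (S - T). f (S - T) \<tau>))"
    unfolding sum_distrib_right by (subst sum.Sigma) (auto simp: fin)
  finally show ?thesis .
qed

subsection \<open>Square-free coefficients\<close>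

lemma submultisets_mset_set:
  assumes "finite S"
  shows "{a. a \<subseteq># mset_set S} = mset_set ` Pow S"
proof (intro equalityI subsetI)
  fix a assume "a \<in> {a. a \<subseteq># mset_set S}"
  then have a: "a \<subseteq># mset_set S" by simp
  then have sub: "set_mset a \<subseteq> S" using assms by (metis finite_set_mset_mset_set set_mset_mono)
  have "count a x = count (mset_set (set_mset a)) x" for x
  proof (cases "x \<in># a")
    case True
    then have "x \<in> S" using sub by auto
    then have "count a x \<le> 1" using mset_subset_eq_count[OF a, of x] assms by simp
    then show ?thesis using True by (simp add: le_antisym Suc_leI)
  qed (simp add: not_in_iff)
  then have "a = mset_set (set_mset a)" by (rule multiset_eqI)
  then show "a \<in> mset_set ` Pow S" using sub by blast
qed (use assms in \<open>auto intro: subset_imp_msubset_mset_set\<close>)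

lemma mps_coeff_mult_mset_set:
  fixes f g :: "('v, 'a::comm_ring_1) mps"
  assumes S: "finite S"
  shows "mps_coeff (f * g) (mset_set S)
    = (\<Sum>T\<in>Pow S. mps_coeff f (mset_set T) * mps_coeff g (mset_set (S - T)))"
proof -
  have inj: "inj_on mset_set (Pow S)"
    using S by (intro inj_onI) (metis PowD finite_set_mset_mset_set finite_subset)
  show ?thesis
    unfolding times_mps.rep_eq submultisets_mset_set[OF S] sum.reindex[OF inj] comp_def
    by (intro sum.cong refl) (metis PowD S finite_subset mset_set_Diff)
qed

text \<open>Repeated variables are ignored; the coefficients are meaningful for the argument at
  square-free monomials, where a monomial is the same as its set of variables.\<close>

lift_definition set_series :: "('v set \<Rightarrow> 'a) \<Rightarrow> ('v, 'a) mps" is "\<lambda>F s. F (set_mset s)" .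

text \<open>The factor from \<open>euler\<close> counts marked points, so
  \<open>cycle_cover_recursion\<close> splits off the marked cycle. Arrangements of its vertex set
  \<open>T\<close> are the cycles on \<open>T\<close> with a marked start, and also the words of the
  square-free monomial \<open>T\<close>. The statistic \<omega> covers the unsigned and the signed
  sum at once.\<close>

lemma euler_cycle_cover_series:
  fixes \<omega> :: "nat set \<Rightarrow> (nat \<Rightarrow> nat) \<Rightarrow> zseries" and a :: "nat \<Rightarrow> nat \<Rightarrow> rat"
  assumes \<omega>: "\<And>S xs \<tau>. finite S \<Longrightarrow> distinct xs \<Longrightarrow> xs \<noteq> [] \<Longrightarrow> set xs \<subseteq> S \<Longrightarrow> \<tau> permutes S - set xs \<Longrightarrow>
      \<omega> S (cycle_of_list xs \<circ> \<tau>) = mps_const (\<epsilon> (length xs)) * p_sym (length xs) * \<omega> (S - set xs) \<tau>"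
    and \<epsilon>: "\<epsilon> 0 = 0" and S: "finite S" "S \<subseteq> V"
  defines "F \<equiv> \<lambda>S. \<Sum>\<sigma> | \<sigma> permutes S. \<omega> S \<sigma> * mps_const (\<Prod>i\<in>S. a i (\<sigma> i))"
  shows "mps_coeff (euler (set_series F)) (mset_set S)
    = mps_coeff (power_sum_series (word_series V (\<lambda>w. \<epsilon> (length w) * cycle_weight a w)) * set_series F) (mset_set S)"
proof -
  let ?K = "word_series V (\<lambda>w. \<epsilon> (length w) * cycle_weight a w)"
  have K: "mps_coeff (power_sum_series ?K) (mset_set T)
      = (\<Sum>xs\<in>permutations_of_set T. mps_const (\<epsilon> (length xs)) * p_sym (length xs) * mps_const (cycle_weight a xs))"
    if T: "T \<subseteq> S" for T
  proof -
    have fin: "finite T" and V: "T \<subseteq> V" using T S finite_subset by auto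
    have "mps_coeff (power_sum_series ?K) (mset_set T)
        = mps_const (\<Sum>xs\<in>permutations_of_set T. \<epsilon> (length xs) * cycle_weight a xs) * p_sym (card T)"
      using fin V by (simp add: power_sum_series.rep_eq word_series.rep_eq permutations_of_set_altdef)
    also have "\<dots> = (\<Sum>xs\<in>permutations_of_set T. mps_const (\<epsilon> (length xs)) * p_sym (length xs) * mps_const (cycle_weight a xs))"
      unfolding mps_const_sum sum_distrib_right
      by (intro sum.cong refl) (simp add: length_finite_permutations_of_set mps_const_mult mult_ac)
    finally show ?thesis .
  qed
  have "mps_coeff (euler (set_series F)) (mset_set S) = of_nat (card S) * F S"
    using S by (simp add: euler.rep_eq set_series.rep_eq)
  also have "\<dots> = (\<Sum>T\<in>Pow S - {{}}. (\<Sum>xs\<in>permutations_of_set T.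
      mps_const (\<epsilon> (length xs)) * p_sym (length xs) * mps_const (cycle_weight a xs)) * F (S - T))"
    unfolding F_def
  proof (rule cycle_cover_recursion[OF S(1)])
    fix xs \<tau> assume A: "distinct xs" "xs \<noteq> []" "set xs \<subseteq> S" "\<tau> permutes S - set xs"
    show "\<omega> S (cycle_of_list xs \<circ> \<tau>) * mps_const (\<Prod>i\<in>S. a i ((cycle_of_list xs \<circ> \<tau>) i))
        = mps_const (\<epsilon> (length xs)) * p_sym (length xs) * mps_const (cycle_weight a xs)
          * (\<omega> (S - set xs) \<tau> * mps_const (\<Prod>i\<in>S - set xs. a i (\<tau> i)))"
      unfolding \<omega>[OF S(1) A] prod_cycle_comp[OF S(1) A] mps_const_mult by (simp only: mult_ac)
  qed
  \<comment> \<open>The empty set may be added because \<open>\<epsilon> 0 = 0\<close> makes the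
    term of the empty list vanish.\<close>
  also have "\<dots> = (\<Sum>T\<in>Pow S. (\<Sum>xs\<in>permutations_of_set T.
      mps_const (\<epsilon> (length xs)) * p_sym (length xs) * mps_const (cycle_weight a xs)) * F (S - T))"
    using S \<epsilon> by (intro sum.mono_neutral_left) auto
  also have "\<dots> = mps_coeff (power_sum_series ?K * set_series F) (mset_set S)"
    unfolding mps_coeff_mult_mset_set[OF S(1)] using S
    by (intro sum.cong refl) (simp add: K set_series.rep_eq)
  finally show ?thesis .
qed

lemma mps_coeff_mult_cong:
  fixes f g :: "('v, 'a::comm_ring_1) mps"
  assumes "\<And>a. a \<subseteq># s \<Longrightarrow> mps_coeff f a = mps_coeff f' a"
  shows "mps_coeff (f * g) s = mps_coeff (f' * g) s"
  unfolding times_mps.rep_eq by (intro sum.cong refl) (simp add: assms)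

section \<open>The three expressions\<close>

lemma power_sum_series_add:
  "power_sum_series (K + L) = power_sum_series K + power_sum_series L"
  by (rule mps_eqI) (simp add: power_sum_series.rep_eq mps_coeff_simps mps_const_add distrib_right)

lemma word_series_add: "word_series V (\<lambda>w. \<phi> w + \<psi> w) = word_series V \<phi> + word_series V \<psi>"
  by (rule mps_eqI) (simp add: word_series.rep_eq mps_coeff_simps sum.distrib)

text \<open>The coefficients of the power sums in the logarithmic derivatives of the generating
  series of \<open>h_sym\<close> and \<open>e_sym\<close>; both leave out
  \<open>k = 0\<close>.\<close>

definition h_sign :: "nat \<Rightarrow> rat" where "h_sign k = (if k = 0 then 0 else 1)"

definition e_sign :: "nat \<Rightarrow> rat" where "e_sign k = (if k = 0 then 0 else (- 1) ^ (k - 1))"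

text \<open>The sum over \<open>k\<close> of \<open>\<epsilon> k\<close>, \<open>p_sym k\<close> and
  the trace of the \<open>k\<close>-th power of \<open>X_mat n * weight_mat n a\<close>, written as
  a word series by \<open>power_sum_series_traces\<close>.\<close>

definition log_series :: "(nat \<Rightarrow> rat) \<Rightarrow> nat \<Rightarrow> (nat \<Rightarrow> nat \<Rightarrow> rat) \<Rightarrow> xseries" where
  "log_series \<epsilon> n a = power_sum_series (word_series {1..n} (\<lambda>w. \<epsilon> (length w) * cycle_weight a w))"

lemma power_sum_series_log_weight:
  "power_sum_series (word_series {1..n} (log_weight a))
    = log_series h_sign n a + log_series e_sign n (\<lambda>x y. 1 - a x y)"
  unfolding log_series_def power_sum_series_add[symmetric] word_series_add[symmetric]
  by (intro arg_cong[where f = power_sum_series] word_series_cong)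
    (simp add: log_weight_def h_sign_def e_sign_def)

lemma log_series_empty: "\<epsilon> 0 = 0 \<Longrightarrow> mps_coeff (log_series \<epsilon> n a) {#} = 0"
  by (simp add: log_series_def power_sum_series.rep_eq word_series.rep_eq)

section \<open>The determinant expression\<close>

lemma co_adjacency_mat_weight: "co_adjacency_mat n E = weight_mat n (non_edge E)"
  by (rule eq_matI) (auto simp: co_adjacency_mat_def adjacency_mat_def weight_mat_def non_edge_def)

lemma adjacency_mat_weight: "adjacency_mat n E = weight_mat n (\<lambda>x y. 1 - non_edge E x y)"
  by (rule eq_matI) (auto simp: adjacency_mat_def weight_mat_def non_edge_def)

lemma det_X_weight_series:
  assumes "\<And>j. of_nat j * c j = (\<Sum>k\<le>j. mps_const (\<epsilon> k) * p_sym k * c (j - k))" "\<epsilon> 0 = 0" "c 0 = 1"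
  shows "euler (det (mat_series c (X_mat n * weight_mat n a)))
      = log_series \<epsilon> n a * det (mat_series c (X_mat n * weight_mat n a))"
    and "mps_coeff (det (mat_series c (X_mat n * weight_mat n a))) {#} = 1"
proof -
  have "euler (det (mat_series c (X_mat n * weight_mat n a)))
      = trace_mat (mat_series (\<lambda>k. mps_const (\<epsilon> k) * p_sym k) (X_mat n * weight_mat n a))
        * det (mat_series c (X_mat n * weight_mat n a))"
    by (rule det_mat_series[OF X_weight_mat_carrier homogeneous_X_weight_mat assms(1)])
  then show "euler (det (mat_series c (X_mat n * weight_mat n a)))
      = log_series \<epsilon> n a * det (mat_series c (X_mat n * weight_mat n a))"
    unfolding trace_mat_series[OF X_weight_mat_carrier] power_sum_series_traces[of \<epsilon>, OF assms(2)]
    by (simp only: log_series_def)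
  show "mps_coeff (det (mat_series c (X_mat n * weight_mat n a))) {#} = 1"
    by (rule det_mat_series_empty[where c = c, OF X_weight_mat_carrier assms(3)])
qed

lemma matrix_series_eq:
  assumes M: "M = X_mat n * weight_mat n a"
  shows "H_mat M = mat_series h_sym M" "E_mat M = mat_series e_sym M"
proof -
  have dim: "dim_row M = n" "dim_col M = n" using X_weight_mat_carrier[of n a] unfolding M by (simp_all only: carrier_matD)
  have "mps_sum (\<lambda>j. mps_const (c j) * (M ^\<^sub>m j) $$ (i, k)) UNIV = graded_sum (\<lambda>j. mps_const (c j) * (M ^\<^sub>m j) $$ (i, k))"
    if "i < n" "k < n" for c i k
    using homogeneous_const_mult[OF homogeneous_pow_mat[OF X_weight_mat_carrier homogeneous_X_weight_mat that]]
    unfolding M by (subst mps_sum_homogeneous) auto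
  then show "H_mat M = mat_series h_sym M" "E_mat M = mat_series e_sym M"
    unfolding H_mat_def E_mat_def mat_series_def dim by (auto intro!: eq_matI)
qed

lemma h_sym_0: "h_sym 0 = 1"
  by (rule mps_eqI) (auto simp: mps_coeff_h_sym one_mps.rep_eq)

lemma e_sym_0: "e_sym 0 = 1"
  by (rule mps_eqI) (auto simp: mps_coeff_e_sym one_mps.rep_eq)

section \<open>The exponential expression\<close>

lemma mps_const_minus_one_power: "mps_const ((- 1) ^ k) = ((- 1) ^ k :: ('v, 'a::comm_ring_1) mps)"
  by (simp add: mps_const_power mps_const_uminus)

lemma homogeneous_trace:
  assumes "k > 0"
  shows "homogeneous k (trace_mat ((X_mat n * weight_mat n a) ^\<^sub>m k))"
proof -
  have "(\<Sum>w\<in>permutations_of_multiset m. if length w = k then mps_const (cycle_weight a w) else 0 :: zseries) = 0"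
    if "size m \<noteq> k" for m
    using that by (intro sum.neutral) (auto simp: length_permutations_of_multiset)
  then show ?thesis
    unfolding homogeneous_def trace_X_weight_mat_pow[OF assms] word_series.rep_eq by metis
qed

text \<open>The \<open>k\<close>-th term is homogeneous of degree \<open>k\<close>, so the Euler
  operator cancels the factor \<open>1 / of_nat k\<close>.\<close>

lemma exponent_series:
  fixes n :: nat and a b :: "nat \<Rightarrow> nat \<Rightarrow> rat"
  defines "t \<equiv> \<lambda>a k. trace_mat ((X_mat n * weight_mat n a) ^\<^sub>m k)"
  defines "f \<equiv> mps_sum (\<lambda>k. mps_const (mps_const (1 / of_nat k) * p_sym k) * (t a k + (- 1) ^ (k - 1) * t b k)) {1..}"
  shows "mps_coeff f {#} = 0" "euler f = log_series h_sign n a + log_series e_sign n b"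
proof -
  have hom: "homogeneous k (mps_const (mps_const (1 / of_nat k) * p_sym k) * (t a k + (- 1) ^ (k - 1) * t b k))"
    if "k \<in> {1..}" for k
  proof (rule homogeneous_const_mult)
    have t: "homogeneous k (t c k)" for c unfolding t_def using that by (intro homogeneous_trace) auto
    then show "homogeneous k (t a k + (- 1) ^ (k - 1) * t b k)"
      using homogeneous_const_mult[OF t[of b], of "(- 1) ^ (k - 1)"]
      unfolding mps_const_minus_one_power homogeneous_def plus_mps.rep_eq by (metis add.right_neutral)
  qed
  have f: "f = graded_sum (\<lambda>k. if k \<in> {1..} then
      mps_const (mps_const (1 / of_nat k) * p_sym k) * (t a k + (- 1) ^ (k - 1) * t b k) else 0)"
    unfolding f_def by (rule mps_sum_homogeneous[OF hom])
  show "mps_coeff f {#} = 0" unfolding f by (simp add: graded_sum.rep_eq zero_mps.rep_eq)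
  have "of_nat k * (if k \<in> {1..} then
      mps_const (mps_const (1 / of_nat k) * p_sym k) * (t a k + (- 1) ^ (k - 1) * t b k) else 0)
    = mps_const (mps_const (h_sign k) * p_sym k) * t a k + mps_const (mps_const (e_sign k) * p_sym k) * t b k" for k
  proof (cases "k = 0")
    case False
    have "of_nat k * mps_const (mps_const (1 / of_nat k) * p_sym k) = (mps_const (p_sym k) :: xseries)"
    proof -
      have "of_nat k * mps_const (mps_const (1 / of_nat k) * p_sym k)
          = (mps_const (mps_const (of_nat k * (1 / of_nat k)) * p_sym k) :: xseries)"
        unfolding mps_const_mult mps_const_of_nat by (simp only: mult.assoc)
      then show ?thesis using False by simp
    qed
    moreover have "mps_const (mps_const (e_sign k) * p_sym k) = (- 1) ^ (k - 1) * (mps_const (p_sym k) :: xseries)"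
      using False by (simp add: e_sign_def mps_const_minus_one_power mps_const_mult)
    ultimately show ?thesis using False by (simp add: h_sign_def distrib_left flip: mult.assoc)
  qed (simp add: h_sign_def e_sign_def)
  then have "euler f = graded_sum (\<lambda>k. mps_const (mps_const (h_sign k) * p_sym k) * t a k
      + mps_const (mps_const (e_sign k) * p_sym k) * t b k)"
    unfolding f euler_graded_sum by (simp only:)
  also have "\<dots> = graded_sum (\<lambda>k. mps_const (mps_const (h_sign k) * p_sym k) * t a k)
      + graded_sum (\<lambda>k. mps_const (mps_const (e_sign k) * p_sym k) * t b k)"
    by (rule mps_eqI) (simp add: graded_sum.rep_eq plus_mps.rep_eq)
  also have "\<dots> = log_series h_sign n a + log_series e_sign n b"
    unfolding t_def log_series_def
    by (subst (1 2) power_sum_series_traces) (simp_all add: h_sign_def e_sign_def)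
  finally show "euler f = log_series h_sign n a + log_series e_sign n b" .
qed

section \<open>The expression by sums over permutations\<close>

definition h_cover :: "(nat \<Rightarrow> nat \<Rightarrow> rat) \<Rightarrow> nat set \<Rightarrow> zseries" where
  "h_cover a S = (\<Sum>\<sigma> | \<sigma> permutes S. p_cyc S \<sigma> * mps_const (\<Prod>i\<in>S. a i (\<sigma> i)))"

definition e_cover :: "(nat \<Rightarrow> nat \<Rightarrow> rat) \<Rightarrow> nat set \<Rightarrow> zseries" where
  "e_cover a S = (\<Sum>\<sigma> | \<sigma> permutes S. p_cyc S \<sigma> * of_int (sign \<sigma>) * mps_const (\<Prod>i\<in>S. a i (\<sigma> i)))"

lemma euler_h_cover:
  assumes "S \<subseteq> {1..n}"
  shows "mps_coeff (euler (set_series (h_cover a))) (mset_set S)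
    = mps_coeff (log_series h_sign n a * set_series (h_cover a)) (mset_set S)"
  unfolding h_cover_def[abs_def] log_series_def
proof (rule euler_cycle_cover_series)
  show "finite S" using assms finite_subset by blast
qed (use assms in \<open>auto simp: h_sign_def p_cyc_cycle_comp\<close>)

text \<open>A cycle of length \<open>k\<close> has sign \<open>(- 1) ^ (k - 1)\<close>, which is the
  sign of the power sum in the elementary case.\<close>

lemma euler_e_cover:
  assumes "S \<subseteq> {1..n}"
  shows "mps_coeff (euler (set_series (e_cover a))) (mset_set S)
    = mps_coeff (log_series e_sign n a * set_series (e_cover a)) (mset_set S)"
  unfolding e_cover_def[abs_def] log_series_def
proof (rule euler_cycle_cover_series)
  show "finite S" using assms finite_subset by blast
  fix S :: "nat set" and xs \<tau>
  assume A: "finite S" "distinct xs" "xs \<noteq> []" "set xs \<subseteq> S" "\<tau> permutes S - set xs"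
  have "permutation \<tau>" using A by (auto simp: permutation_permutes)
  then have "sign (cycle_of_list xs \<circ> \<tau>) = (- 1) ^ (length xs - 1) * sign \<tau>"
    by (simp add: sign_compose permutation_of_cycle sign_cycle_of_list A(2))
  moreover have "mps_const (e_sign (length xs)) = ((- 1) ^ (length xs - 1) :: zseries)"
    using A(3) by (simp add: e_sign_def mps_const_minus_one_power)
  ultimately show "p_cyc S (cycle_of_list xs \<circ> \<tau>) * of_int (sign (cycle_of_list xs \<circ> \<tau>))
      = mps_const (e_sign (length xs)) * p_sym (length xs) * (p_cyc (S - set xs) \<tau> * of_int (sign \<tau>))"
    by (simp only: p_cyc_cycle_comp[OF A] of_int_mult of_int_power of_int_minus of_int_1 mult_ac)
qed (use assms in \<open>auto simp: e_sign_def\<close>)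

lemma cover_empty: "h_cover a {} = 1" "e_cover a {} = 1"
  by (simp_all add: h_cover_def e_cover_def p_cyc_def)

theorem theorem10:
  fixes n :: nat and E :: "(nat \<times> nat) set"
  assumes "E \<subseteq> {1..n} \<times> {1..n}"
  shows
    "redei_berge n E =
       multilinear_coeff n
         (det (H_mat (X_mat n * co_adjacency_mat n E)) * det (E_mat (X_mat n * adjacency_mat n E)))
     \<and> redei_berge n E =
       multilinear_coeff n
         (mps_exp (mps_sum (\<lambda>k. mps_const (mps_const (1 / of_nat k) * p_sym k) *
            (trace_mat ((X_mat n * co_adjacency_mat n E) ^\<^sub>m k)
             + (-1) ^ (k - 1) * trace_mat ((X_mat n * adjacency_mat n E) ^\<^sub>m k))) {1..}))
     \<and> redei_berge n E =
       (\<Sum>I\<in>Pow {1..n}.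
          (\<Sum>\<sigma> | \<sigma> permutes ({1..n} - I).
             p_cyc ({1..n} - I) \<sigma> * (\<Prod>i\<in>{1..n} - I. entry (co_adjacency_mat n E) i (\<sigma> i)))
          * (\<Sum>\<tau> | \<tau> permutes I.
             p_cyc I \<tau> * of_int (sign \<tau>) * (\<Prod>i\<in>I. entry (adjacency_mat n E) i (\<tau> i))))"
proof -
  let ?a = "non_edge E :: nat \<Rightarrow> nat \<Rightarrow> rat"
  let ?b = "\<lambda>x y. 1 - ?a x y"
  let ?V = "mset_set {1..n}"
  define \<Phi> where "\<Phi> = log_series h_sign n ?a + log_series e_sign n ?b"
  have sign0: "h_sign 0 = 0" "e_sign 0 = 0" by (simp_all add: h_sign_def e_sign_def)
  have \<Phi>0: "mps_coeff \<Phi> {#} = 0"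
    by (simp add: \<Phi>_def plus_mps.rep_eq log_series_empty sign0)
  define U where "U = colour_product (word_series {1..n} (path_weight ?a))"
  have redei: "redei_berge n E = mps_coeff U ?V"
    unfolding U_def redei_berge_colour_product multilinear_coeff_def ..
  have H0: "mps_coeff (word_series {1..n} (path_weight ?a)) {#} = 1"
    by (simp add: word_series.rep_eq path_weight_def)
  have U: "euler U = \<Phi> * U" "mps_coeff U {#} = 1"
    unfolding U_def \<Phi>_def power_sum_series_log_weight[symmetric]
    using euler_colour_product[OF H0 euler_path_series] colour_product_empty[OF H0] by simp_all
  \<comment> \<open>The common criterion for all three expressions; the equation is demanded only at
    divisors of the square-free monomial.\<close>
  have solution: "redei_berge n E = mps_coeff F ?V"
    if "mps_coeff F {#} = 1" "\<And>m. m \<subseteq># ?V \<Longrightarrow> mps_coeff (euler F) m = mps_coeff (\<Phi> * F) m" for F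
    unfolding redei by (rule euler_solution_unique[OF \<Phi>0, where M = ?V]) (simp_all add: U that)

  let ?MA = "X_mat n * weight_mat n ?a" and ?MB = "X_mat n * weight_mat n ?b"
  note det_h = det_X_weight_series[where c = h_sym, OF newton_h[folded h_sign_def] sign0(1) h_sym_0]
  note det_e = det_X_weight_series[where c = e_sym, OF newton_e[folded e_sign_def] sign0(2) e_sym_0]
  have "euler (det (mat_series h_sym ?MA) * det (mat_series e_sym ?MB))
      = \<Phi> * (det (mat_series h_sym ?MA) * det (mat_series e_sym ?MB))"
    unfolding euler_mult \<Phi>_def
    unfolding det_h det_e by (simp only: algebra_simps)
  moreover have "mps_coeff (det (mat_series h_sym ?MA) * det (mat_series e_sym ?MB)) {#} = 1"
    by (simp add: det_h det_e)
  ultimately have a: "redei_berge n E = mps_coeff (det (H_mat ?MA) * det (E_mat ?MB)) ?V"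
    by (simp only: matrix_series_eq[OF refl] solution)

  have b: "redei_berge n E = mps_coeff (mps_exp (mps_sum (\<lambda>k. mps_const (mps_const (1 / of_nat k) * p_sym k) *
      (trace_mat (?MA ^\<^sub>m k) + (-1) ^ (k - 1) * trace_mat (?MB ^\<^sub>m k))) {1..})) ?V"
    by (rule solution) (simp_all only: mps_exp_empty euler_exp exponent_series \<Phi>_def)

  define P where "P = set_series (h_cover ?a)"
  define Q where "Q = set_series (e_cover ?b)"
  have c: "redei_berge n E = mps_coeff (P * Q) ?V"
  proof (rule solution)
    show "mps_coeff (P * Q) {#} = 1" by (simp add: P_def Q_def set_series.rep_eq cover_empty)
    fix m assume m: "m \<subseteq># ?V"
    \<comment> \<open>All divisors of \<open>m\<close> are square-free, and there the equations for
      \<open>P\<close> and \<open>Q\<close> are available.\<close>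
    have sub: "\<exists>S\<subseteq>{1..n}. s = mset_set S" if "s \<subseteq># m" for s
    proof -
      have "s \<in> {s. s \<subseteq># ?V}" using subset_mset.order_trans[OF that m] by simp
      then show ?thesis unfolding submultisets_mset_set[OF finite_atLeastAtMost] by auto
    qed
    have "mps_coeff (euler P * Q) m = mps_coeff (log_series h_sign n ?a * P * Q) m"
      unfolding P_def by (rule mps_coeff_mult_cong) (metis sub euler_h_cover)
    moreover have "mps_coeff (euler Q * P) m = mps_coeff (log_series e_sign n ?b * Q * P) m"
      unfolding Q_def by (rule mps_coeff_mult_cong) (metis sub euler_e_cover)
    ultimately show "mps_coeff (euler (P * Q)) m = mps_coeff (\<Phi> * (P * Q)) m"
      by (simp add: euler_mult \<Phi>_def plus_mps.rep_eq distrib_left distrib_right mult_ac)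
  qed
  \<comment> \<open>Since \<sigma> keeps \<open>S\<close> within \<open>{1..n}\<close>, the index
    shift of \<open>entry\<close> never truncates at 0 and is undone by the shift in the
    matrices.\<close>
  have entries: "(\<Prod>i\<in>S. entry (co_adjacency_mat n E) i (\<sigma> i)) = (mps_const (\<Prod>i\<in>S. ?a i (\<sigma> i)) :: zseries)"
    "(\<Prod>i\<in>S. entry (adjacency_mat n E) i (\<sigma> i)) = (mps_const (\<Prod>i\<in>S. ?b i (\<sigma> i)) :: zseries)"
    if "\<sigma> permutes S" "S \<subseteq> {1..n}" for \<sigma> S
  proof -
    have "i \<in> {1..n}" "\<sigma> i \<in> {1..n}" if "i \<in> S" for i
      using that \<open>S \<subseteq> {1..n}\<close> permutes_in_image[OF \<open>\<sigma> permutes S\<close>, of i] by auto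
    then have "i - 1 < n" "\<sigma> i - 1 < n" "Suc (i - 1) = i" "Suc (\<sigma> i - 1) = \<sigma> i" if "i \<in> S" for i
      using that by fastforce+
    then show "(\<Prod>i\<in>S. entry (co_adjacency_mat n E) i (\<sigma> i)) = (mps_const (\<Prod>i\<in>S. ?a i (\<sigma> i)) :: zseries)"
      "(\<Prod>i\<in>S. entry (adjacency_mat n E) i (\<sigma> i)) = (mps_const (\<Prod>i\<in>S. ?b i (\<sigma> i)) :: zseries)"
      unfolding mps_const_prod
      by (auto intro!: prod.cong simp: entry_def co_adjacency_mat_def adjacency_mat_def non_edge_def)
  qed
  \<comment> \<open>The factors are exchanged so that the subset \<open>I\<close> belongs to
    \<open>e_cover\<close> and its complement to \<open>h_cover\<close>.\<close>
  have "mps_coeff (P * Q) ?V = (\<Sum>I\<in>Pow {1..n}. h_cover ?a ({1..n} - I) * e_cover ?b I)"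
    unfolding mult.commute[of P] mps_coeff_mult_mset_set[OF finite_atLeastAtMost]
    by (intro sum.cong refl) (auto simp: P_def Q_def set_series.rep_eq mult.commute finite_subset)
  also have "\<dots> = (\<Sum>I\<in>Pow {1..n}.
          (\<Sum>\<sigma> | \<sigma> permutes ({1..n} - I).
             p_cyc ({1..n} - I) \<sigma> * (\<Prod>i\<in>{1..n} - I. entry (co_adjacency_mat n E) i (\<sigma> i)))
          * (\<Sum>\<tau> | \<tau> permutes I.
             p_cyc I \<tau> * of_int (sign \<tau>) * (\<Prod>i\<in>I. entry (adjacency_mat n E) i (\<tau> i))))"
    unfolding h_cover_def e_cover_def
    by (intro sum.cong arg_cong2[where f = "(*)"] refl) (simp_all add: entries)
  finally show ?thesis
    using a b c unfolding multilinear_coeff_def co_adjacency_mat_weight adjacency_mat_weight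
    by (simp only:)
qed

end
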